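(* Let $G=(V,E)$ be a finite simple graph with $|V|\ge 3$ which is not a complete graph, and let $k\ge 3$. Then the graph Lie algebra $\mathfrak{g}(k,G)$ over $\mathbb{C}$ is not $k$-rigid.
   Context: All Lie algebras are finite dimensional over $\mathbb{C}$. Graph Lie algebras. For a Lie algebra $\mathfrak{g}$ put $\mathfrak{g}^1=\mathfrak{g}$, $\mathfrak{g}^{i+1}=[\mathfrak{g},\mathfrak{g}^i]$. Then $\mathfrak{g}$ is $k$-step nilpotent if $\mathfrak{g}^{k+1}=0$ and $\mathfrak{g}^k\neq 0$, and at most $k$-step nilpotent if $\mathfrak{g}^{k+1}=0$. Let $G=(V,E)$ be a simple graph with vertices $V=\{v_1,\dots,v_m\}$ and edge set $E$, a set of two-element subsets of $V$. Let $L_{(k)}(m)$ be the free $k$-step nilpotent Lie algebra on the generators $v_1,\dots,v_m$ (the quotient of the free Lie algebra $L$ on $v_1,\dots,v_m$ by $L^{k+1}$), and let $I$ be the ideal of $L_{(k)}(m)$ generated by the brackets $[v_i,v_j]$ with $i\ne j$ and $\{v_i,v_j\}\notin E$. The $k$-step nilpotent Lie algebra associated with $G$ is $\mathfrak{g}(k,G)=L_{(k)}(m)/I$. (If $G$ has no edges, $\mathfrak{g}(k,G)$ is abelian; this case is allowed.) Rigidity. Let $\mathcal{N}_{n,k}$ be the algebraic variety of all Lie brackets $\mu$ on $\mathbb{C}^n$ such that $(\mathbb{C}^n,\mu)$ is at most $k$-step nilpotent. The group $GL(n,\mathbb{C})$ acts on it by $g\cdot\mu(x,y)=g\,\mu(g^{-1}x,g^{-1}y)$,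 and the orbit $\mathcal{O}(\mu)$ is the isomorphism class of $\mu$. A bracket $\mu\in\mathcal{N}_{n,k}$ (or the corresponding Lie algebra of dimension $n$) is called $k$-rigid if $\mathcal{O}(\mu)$ is Zariski open in $\mathcal{N}_{n,k}$. *)

theory Defs
  imports "HOL-Algebra.QuotRing" "Jordan_Normal_Form.VS_Connect"
begin

section \<open>Algebras and Lie algebras over the complex numbers\<close>

text \<open>
  A (not necessarily associative) complex algebra is a record of type
  \<open>(complex, 'a) module\<close> whose field \<open>mult\<close> is the bilinear product; for a Lie algebra \<open>L\<close>
  the bracket of \<open>x\<close> and \<open>y\<close> is therefore written \<open>x \<otimes>\<^bsub>L\<^esub> y\<close>. The record field \<open>one\<close> plays no role.
\<close>

locale complex_lie_algebra = vectorspace "class_ring :: complex ring" L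
  for L :: "(complex, 'a) module" (structure) +
  assumes bracket_closed: "\<lbrakk>x \<in> carrier L; y \<in> carrier L\<rbrakk> \<Longrightarrow> x \<otimes> y \<in> carrier L"
    and bracket_add_left: "\<lbrakk>x \<in> carrier L; y \<in> carrier L; z \<in> carrier L\<rbrakk>
      \<Longrightarrow> (x \<oplus> y) \<otimes> z = (x \<otimes> z) \<oplus> (y \<otimes> z)"
    and bracket_add_right: "\<lbrakk>x \<in> carrier L; y \<in> carrier L; z \<in> carrier L\<rbrakk>
      \<Longrightarrow> x \<otimes> (y \<oplus> z) = (x \<otimes> y) \<oplus> (x \<otimes> z)"
    and bracket_smult_left: "\<lbrakk>x \<in> carrier L; y \<in> carrier L\<rbrakk>
      \<Longrightarrow> (c \<odot> x) \<otimes> y = c \<odot> (x \<otimes> y)"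
    and bracket_smult_right: "\<lbrakk>x \<in> carrier L; y \<in> carrier L\<rbrakk>
      \<Longrightarrow> x \<otimes> (c \<odot> y) = c \<odot> (x \<otimes> y)"
    and bracket_self: "x \<in> carrier L \<Longrightarrow> x \<otimes> x = \<zero>"
    and jacobi: "\<lbrakk>x \<in> carrier L; y \<in> carrier L; z \<in> carrier L\<rbrakk>
      \<Longrightarrow> (x \<otimes> (y \<otimes> z)) \<oplus> (y \<otimes> (z \<otimes> x)) \<oplus> (z \<otimes> (x \<otimes> y)) = \<zero>"

definition lie_isomorphic :: "(complex, 'a) module \<Rightarrow> (complex, 'b) module \<Rightarrow> bool" where
  "lie_isomorphic L M \<longleftrightarrow>
     (\<exists>f \<in> LinearCombinations.module_hom class_ring L M. bij_betw f (carrier L) (carrier M) \<and>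
        (\<forall>x \<in> carrier L. \<forall>y \<in> carrier L. f (x \<otimes>\<^bsub>L\<^esub> y) = f x \<otimes>\<^bsub>M\<^esub> f y))"

text \<open>Indices are shifted by one: \<open>lower_central L i\<close> is \<open>L\<^sup>i\<^sup>+\<^sup>1\<close> in the convention \<open>L\<^sup>1 = L\<close>,
  \<open>L\<^sup>i\<^sup>+\<^sup>1 = [L, L\<^sup>i]\<close>.\<close>

primrec lower_central :: "(complex, 'a) module \<Rightarrow> nat \<Rightarrow> 'a set" where
  "lower_central L 0 = carrier L"
| "lower_central L (Suc i) =
     LinearCombinations.module.span class_ring L {x \<otimes>\<^bsub>L\<^esub> y | x y. x \<in> carrier L \<and> y \<in> lower_central L i}"

definition at_most_step_nilpotent :: "nat \<Rightarrow> (complex, 'a) module \<Rightarrow> bool" where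
  "at_most_step_nilpotent k L \<longleftrightarrow> lower_central L k = {\<zero>\<^bsub>L\<^esub>}"

definition algebra_ideal :: "'a set \<Rightarrow> (complex, 'a) module \<Rightarrow> bool" where
  "algebra_ideal I A \<longleftrightarrow> VectorSpace.subspace class_ring I A \<and>
     (\<forall>x \<in> carrier A. \<forall>a \<in> I. x \<otimes>\<^bsub>A\<^esub> a \<in> I \<and> a \<otimes>\<^bsub>A\<^esub> x \<in> I)"

definition ideal_generated :: "(complex, 'a) module \<Rightarrow> 'a set \<Rightarrow> 'a set" where
  "ideal_generated A S = \<Inter> {I. algebra_ideal I A \<and> S \<subseteq> I}"

definition quotient_algebra :: "(complex, 'a) module \<Rightarrow> 'a set \<Rightarrow> (complex, 'a set) module" where
  "quotient_algebra A I =
     \<lparr>carrier = a_rcosets\<^bsub>A\<^esub> I, mult = rcoset_mult A I, one = undefined, zero = I,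
      add = set_add A, smult = (\<lambda>c X. \<Union>x\<in>X. I +>\<^bsub>A\<^esub> (c \<odot>\<^bsub>A\<^esub> x))\<rparr>"


section \<open>Free Lie algebras and graph Lie algebras\<close>

text \<open>The free Lie algebra on \<open>V\<close> is the algebra of the free magma on \<open>V\<close> (the free
  nonassociative algebra) modulo the ideal enforcing \<open>[x,x] = 0\<close> and the Jacobi identity.\<close>

datatype (vertices: 'v) magma = Gen 'v | Prod "'v magma" "'v magma"

text \<open>Every magma word is a generator or has a unique factorisation into two words, so the bilinear
  extension of \<open>Prod\<close> to formal linear combinations has the coefficients below.\<close>

primrec magma_mult :: "('v magma \<Rightarrow> complex) \<Rightarrow> ('v magma \<Rightarrow> complex) \<Rightarrow> 'v magma \<Rightarrow> complex" where
  "magma_mult f g (Gen v) = 0"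
| "magma_mult f g (Prod s t) = f s * g t"

definition magma_algebra :: "'v set \<Rightarrow> (complex, 'v magma \<Rightarrow> complex) module" where
  "magma_algebra V =
     \<lparr>carrier = {f. finite {w. f w \<noteq> 0} \<and> (\<forall>w. f w \<noteq> 0 \<longrightarrow> vertices w \<subseteq> V)},
      mult = magma_mult, one = undefined, zero = (\<lambda>w. 0),
      add = (\<lambda>f g w. f w + g w), smult = (\<lambda>c f w. c * f w)\<rparr>"

definition lie_relators :: "(complex, 'a) module \<Rightarrow> 'a set" where
  "lie_relators A = {x \<otimes>\<^bsub>A\<^esub> x | x. x \<in> carrier A} \<union>
     {(x \<otimes>\<^bsub>A\<^esub> (y \<otimes>\<^bsub>A\<^esub> z)) \<oplus>\<^bsub>A\<^esub> (y \<otimes>\<^bsub>A\<^esub> (z \<otimes>\<^bsub>A\<^esub> x)) \<oplus>\<^bsub>A\<^esub> (z \<otimes>\<^bsub>A\<^esub> (x \<otimes>\<^bsub>A\<^esub> y)) | x y z.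
        x \<in> carrier A \<and> y \<in> carrier A \<and> z \<in> carrier A}"

definition lie_relation_ideal :: "'v set \<Rightarrow> ('v magma \<Rightarrow> complex) set" where
  "lie_relation_ideal V = ideal_generated (magma_algebra V) (lie_relators (magma_algebra V))"

definition free_lie_algebra :: "'v set \<Rightarrow> (complex, ('v magma \<Rightarrow> complex) set) module" where
  "free_lie_algebra V = quotient_algebra (magma_algebra V) (lie_relation_ideal V)"

definition free_lie_gen :: "'v set \<Rightarrow> 'v \<Rightarrow> ('v magma \<Rightarrow> complex) set" where
  "free_lie_gen V v =
     lie_relation_ideal V +>\<^bsub>magma_algebra V\<^esub> (\<lambda>w. if w = Gen v then 1 else 0)"

text \<open>The quotient of the free Lie algebra \<open>L\<close> by \<open>L\<^sup>k\<^sup>+\<^sup>1\<close>.\<close>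

definition free_nilpotent_lie_algebra ::
  "nat \<Rightarrow> 'v set \<Rightarrow> (complex, ('v magma \<Rightarrow> complex) set set) module" where
  "free_nilpotent_lie_algebra k V =
     quotient_algebra (free_lie_algebra V) (lower_central (free_lie_algebra V) k)"

definition free_nilpotent_gen :: "nat \<Rightarrow> 'v set \<Rightarrow> 'v \<Rightarrow> ('v magma \<Rightarrow> complex) set set" where
  "free_nilpotent_gen k V v =
     lower_central (free_lie_algebra V) k +>\<^bsub>free_lie_algebra V\<^esub> free_lie_gen V v"

definition all_edges :: "'v set \<Rightarrow> 'v set set" where
  "all_edges V = {{u, v} | u v. u \<in> V \<and> v \<in> V \<and> u \<noteq> v}"

definition finite_simple_graph :: "'v set \<Rightarrow> 'v set set \<Rightarrow> bool" where
  "finite_simple_graph V E \<longleftrightarrow> finite V \<and> E \<subseteq> all_edges V"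

definition complete_graph :: "'v set \<Rightarrow> 'v set set \<Rightarrow> bool" where
  "complete_graph V E \<longleftrightarrow> E = all_edges V"

definition graph_ideal :: "nat \<Rightarrow> 'v set \<Rightarrow> 'v set set \<Rightarrow> ('v magma \<Rightarrow> complex) set set set" where
  "graph_ideal k V E =
     ideal_generated (free_nilpotent_lie_algebra k V)
       {free_nilpotent_gen k V u \<otimes>\<^bsub>free_nilpotent_lie_algebra k V\<^esub> free_nilpotent_gen k V v | u v.
          u \<in> V \<and> v \<in> V \<and> u \<noteq> v \<and> {u, v} \<notin> E}"

definition graph_lie_algebra ::
  "nat \<Rightarrow> 'v set \<Rightarrow> 'v set set \<Rightarrow> (complex, ('v magma \<Rightarrow> complex) set set set) module" where
  "graph_lie_algebra k V E =
     quotient_algebra (free_nilpotent_lie_algebra k V) (graph_ideal k V E)"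


section \<open>The variety of nilpotent Lie brackets and rigidity\<close>

type_synonym bracket = "complex vec \<Rightarrow> complex vec \<Rightarrow> complex vec"

definition bracket_algebra :: "nat \<Rightarrow> bracket \<Rightarrow> (complex, complex vec) module" where
  "bracket_algebra n \<mu> = module_vec TYPE(complex) n \<lparr>mult := \<mu>\<rparr>"

text \<open>Brackets are normalised to be \<open>undefined\<close> outside \<open>\<complex>\<^sup>n\<close>, so that equality of functions is
  equality of brackets.\<close>

definition nilpotent_brackets :: "nat \<Rightarrow> nat \<Rightarrow> bracket set" where
  "nilpotent_brackets n k =
     {\<mu> \<in> carrier_vec n \<rightarrow>\<^sub>E (carrier_vec n \<rightarrow>\<^sub>E carrier_vec n).
        complex_lie_algebra (bracket_algebra n \<mu>) \<and>
        at_most_step_nilpotent k (bracket_algebra n \<mu>)}"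

abbreviation complex_mat_ring :: "nat \<Rightarrow> complex mat ring" where
  "complex_mat_ring n \<equiv> ring_mat TYPE(complex) n ()"

definition GL_complex :: "nat \<Rightarrow> complex mat set" where
  "GL_complex n = Units (complex_mat_ring n)"

definition GL_action :: "nat \<Rightarrow> complex mat \<Rightarrow> bracket \<Rightarrow> bracket" where
  "GL_action n g \<mu> =
     (\<lambda>x \<in> carrier_vec n. \<lambda>y \<in> carrier_vec n.
        g *\<^sub>v \<mu> (inv\<^bsub>complex_mat_ring n\<^esub> g *\<^sub>v x) (inv\<^bsub>complex_mat_ring n\<^esub> g *\<^sub>v y))"

definition bracket_orbit :: "nat \<Rightarrow> bracket \<Rightarrow> bracket set" where
  "bracket_orbit n \<mu> = {GL_action n g \<mu> | g. g \<in> GL_complex n}"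

text \<open>Polynomial functions in the structure constants, that is, in the coordinates of
  \<open>\<mu>(e\<^sub>i, e\<^sub>j)\<close>.\<close>

inductive_set bracket_polynomials :: "nat \<Rightarrow> (bracket \<Rightarrow> complex) set" for n :: nat where
  const: "(\<lambda>_. c) \<in> bracket_polynomials n"
| coord: "\<lbrakk>i < n; j < n; l < n\<rbrakk> \<Longrightarrow>
    (\<lambda>\<mu>. \<mu> (unit_vec n i) (unit_vec n j) $ l) \<in> bracket_polynomials n"
| add: "\<lbrakk>p \<in> bracket_polynomials n; q \<in> bracket_polynomials n\<rbrakk> \<Longrightarrow>
    (\<lambda>\<mu>. p \<mu> + q \<mu>) \<in> bracket_polynomials n"
| mult: "\<lbrakk>p \<in> bracket_polynomials n; q \<in> bracket_polynomials n\<rbrakk> \<Longrightarrow>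
    (\<lambda>\<mu>. p \<mu> * q \<mu>) \<in> bracket_polynomials n"

definition zariski_open_in :: "nat \<Rightarrow> bracket set \<Rightarrow> bracket set \<Rightarrow> bool" where
  "zariski_open_in n X U \<longleftrightarrow>
     (\<exists>P \<subseteq> bracket_polynomials n. U = X - {\<mu>. \<forall>p \<in> P. p \<mu> = 0})"

definition k_rigid_bracket :: "nat \<Rightarrow> nat \<Rightarrow> bracket \<Rightarrow> bool" where
  "k_rigid_bracket n k \<mu> \<longleftrightarrow> \<mu> \<in> nilpotent_brackets n k \<and>
     zariski_open_in n (nilpotent_brackets n k) (bracket_orbit n \<mu>)"

text \<open>A Lie algebra is rigid if the brackets on \<open>\<complex>\<^sup>n\<close> defining it are. These form a single
  \<open>GL(n,\<complex>)\<close>-orbit, so it is immaterial which of them is taken.\<close>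

definition k_rigid :: "nat \<Rightarrow> (complex, 'a) module \<Rightarrow> bool" where
  "k_rigid k L \<longleftrightarrow>
     (\<exists>n \<mu>. lie_isomorphic L (bracket_algebra n \<mu>) \<and> k_rigid_bracket n k \<mu>)"

end

theory Submission
  imports Defs
begin

text \<open>
  If \<open>G\<close> has an edge, there are a non-edge \<open>{u, w}\<close> and an edge \<open>{c, u}\<close>. With \<open>z = (ad c)\<^sup>k\<^sup>-\<^sup>1 u\<close>,
  which is central, and with \<open>a\<close>, \<open>b\<close> the coordinate functionals of \<open>u\<close> and \<open>w\<close> on
  \<open>\<gg>/[\<gg>,\<gg>]\<close>, the brackets \<open>\<mu>\<^sub>t = \<mu> + t (a \<and> b) z\<close> all lie in the variety. Suppose that
  \<open>\<psi>\<close> is an isomorphism from \<open>\<mu>\<^sub>t\<close> to \<open>\<mu>\<close> with inverse \<open>\<phi>\<close>. As \<open>[\<psi> u, \<psi> w] = t \<psi> z\<close> is a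
  bracket of length \<open>k \<ge> 3\<close>, its component of degree two vanishes, that is, the parts \<open>u'\<close>, \<open>w'\<close> of
  \<open>\<psi> u\<close>, \<open>\<psi> w\<close> of degree one commute. Hence \<open>\<phi> u'\<close> and \<open>\<phi> w'\<close> commute for \<open>\<mu>\<^sub>t\<close>, and they
  agree with \<open>u\<close> and \<open>w\<close> modulo brackets. In the filiform quotient of \<open>\<gg>\<close> spanned by
  \<open>c\<close>, \<open>u\<close>, \<open>[c,u]\<close>, \<open>[c,[c,u]]\<close>, \<open>\<dots>\<close> their \<open>\<mu>\<close>-bracket vanishes, so their \<open>\<mu>\<^sub>t\<close>-bracket
  has the image of \<open>t z\<close>, and \<open>t = 0\<close>. If \<open>G\<close> has no edges, then \<open>\<gg>\<close> is abelian and
  \<open>[u,w] = t s\<close> for three vertices \<open>u\<close>, \<open>w\<close>, \<open>s\<close> is not.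
  Along the line \<open>\<mu>\<^sub>t\<close> a polynomial that does not vanish at \<open>t = 0\<close> vanishes only finitely often, so
  the orbit of \<open>\<mu>\<close> is not Zariski open.
\<close>

section \<open>Algebras, ideals and quotients\<close>

text \<open>Quotients, ideals and the lower central series are built from bilinearity alone. This
  common setting covers the free nonassociative algebra, which is not a Lie algebra, together with
  all its quotients.\<close>

locale complex_algebra = vectorspace "class_ring :: complex ring" A
  for A :: "(complex, 'a) module" (structure) +
  assumes mult_closed: "\<lbrakk>x \<in> carrier A; y \<in> carrier A\<rbrakk> \<Longrightarrow> x \<otimes> y \<in> carrier A"
    and mult_add_left: "\<lbrakk>x \<in> carrier A; y \<in> carrier A; z \<in> carrier A\<rbrakk>
      \<Longrightarrow> (x \<oplus> y) \<otimes> z = (x \<otimes> z) \<oplus> (y \<otimes> z)"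
    and mult_add_right: "\<lbrakk>x \<in> carrier A; y \<in> carrier A; z \<in> carrier A\<rbrakk>
      \<Longrightarrow> x \<otimes> (y \<oplus> z) = (x \<otimes> y) \<oplus> (x \<otimes> z)"
    and mult_smult_left: "\<lbrakk>x \<in> carrier A; y \<in> carrier A\<rbrakk> \<Longrightarrow> (c \<odot> x) \<otimes> y = c \<odot> (x \<otimes> y)"
    and mult_smult_right: "\<lbrakk>x \<in> carrier A; y \<in> carrier A\<rbrakk> \<Longrightarrow> x \<otimes> (c \<odot> y) = c \<odot> (x \<otimes> y)"

lemma complex_vectorspaceI:
  fixes A :: "(complex, 'a) module" (structure)
  assumes "abelian_group A"
    and "\<And>c x. x \<in> carrier A \<Longrightarrow> c \<odot> x \<in> carrier A"
    and "\<And>c d x. x \<in> carrier A \<Longrightarrow> (c + d) \<odot> x = (c \<odot> x) \<oplus> (d \<odot> x)"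
    and "\<And>c x y. \<lbrakk>x \<in> carrier A; y \<in> carrier A\<rbrakk> \<Longrightarrow> c \<odot> (x \<oplus> y) = (c \<odot> x) \<oplus> (c \<odot> y)"
    and "\<And>c d x. x \<in> carrier A \<Longrightarrow> (c * d) \<odot> x = c \<odot> (d \<odot> x)"
    and "\<And>x. x \<in> carrier A \<Longrightarrow> 1 \<odot> x = x"
  shows "vectorspace (class_ring :: complex ring) A"
proof -
  have "Module.module (class_ring :: complex ring) A"
    by (rule moduleI) (use assms in \<open>auto intro: class_cring.is_cring\<close>)
  then show ?thesis
    unfolding vectorspace_def using class_field by auto
qed

context complex_algebra
begin

lemma smult_mem [simp]: "x \<in> carrier A \<Longrightarrow> c \<odot> x \<in> carrier A"
  using smult_closed[of c x] by simp

lemma smult_add: "x \<in> carrier A \<Longrightarrow> (c + d) \<odot> x = (c \<odot> x) \<oplus> (d \<odot> x)"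
  using smult_l_distr[of c d x] by simp

lemma smult_distrib: "\<lbrakk>x \<in> carrier A; y \<in> carrier A\<rbrakk> \<Longrightarrow> c \<odot> (x \<oplus> y) = (c \<odot> x) \<oplus> (c \<odot> y)"
  using smult_r_distr[of c x y] by simp

lemma smult_smult: "x \<in> carrier A \<Longrightarrow> c \<odot> (d \<odot> x) = (c * d) \<odot> x"
  using smult_assoc1[of c d x] by simp

lemma smult_1 [simp]: "x \<in> carrier A \<Longrightarrow> 1 \<odot> x = x"
  using smult_one[of x] by simp

lemma smult_0 [simp]: "x \<in> carrier A \<Longrightarrow> 0 \<odot> x = \<zero>"
  using smult_l_null[of x] by simp

lemma smult_zero [simp]: "c \<odot> \<zero> = \<zero>"
  using smult_r_null[of c] by simp

lemma mult_zero_left [simp]: "x \<in> carrier A \<Longrightarrow> \<zero> \<otimes> x = \<zero>"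
  using mult_smult_left[of \<zero> x 0] by (simp add: mult_closed)

lemma mult_zero_right [simp]: "x \<in> carrier A \<Longrightarrow> x \<otimes> \<zero> = \<zero>"
  using mult_smult_right[of x \<zero> 0] by (simp add: mult_closed)

lemma neg_eq_smult: "x \<in> carrier A \<Longrightarrow> \<ominus> x = (-1) \<odot> x"
proof -
  assume x: "x \<in> carrier A"
  have "((-1) \<odot> x) \<oplus> x = \<zero>" using smult_add[OF x, of "-1" 1] x by simp
  then show ?thesis using x by (intro M.minus_equality) auto
qed

section \<open>Subspaces, the lower central series and generated ideals\<close>

lemma subspaceI:
  assumes "W \<subseteq> carrier A" "\<zero> \<in> W"
    and "\<And>x y. \<lbrakk>x \<in> W; y \<in> W\<rbrakk> \<Longrightarrow> x \<oplus> y \<in> W" and "\<And>c x. x \<in> W \<Longrightarrow> c \<odot> x \<in> W"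
  shows "VectorSpace.subspace class_ring W A"
  unfolding subspace_def submodule_def
  using assms vectorspace_axioms module_axioms by auto

lemma subspaceD:
  assumes "VectorSpace.subspace class_ring W A"
  shows "W \<subseteq> carrier A" "\<zero> \<in> W"
    and "\<And>x y. \<lbrakk>x \<in> W; y \<in> W\<rbrakk> \<Longrightarrow> x \<oplus> y \<in> W" and "\<And>c x. x \<in> W \<Longrightarrow> c \<odot> x \<in> W"
  using assms unfolding subspace_def submodule_def by auto

lemma span_minimal:
  assumes "VectorSpace.subspace class_ring W A" "S \<subseteq> W"
  shows "span S \<subseteq> W"
  using assms span_is_subset is_module by blast

lemma lower_central_subspace: "VectorSpace.subspace class_ring (lower_central A i) A"
proof (induction i)
  case 0
  show ?case by (auto intro!: subspaceI)
next
  case (Suc i)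
  then show ?case
    using subspaceD(1)[OF Suc] by (auto intro!: span_is_subspace mult_closed)
qed

lemma lower_central_closed: "x \<in> lower_central A i \<Longrightarrow> x \<in> carrier A"
  using subspaceD(1)[OF lower_central_subspace] by blast

lemma mult_mem_lower_central:
  "\<lbrakk>x \<in> carrier A; y \<in> lower_central A i\<rbrakk> \<Longrightarrow> x \<otimes> y \<in> lower_central A (Suc i)"
  using in_own_span[of "{x \<otimes> y | x y. x \<in> carrier A \<and> y \<in> lower_central A i}"]
  by (auto intro: mult_closed lower_central_closed)

lemma lower_central_subset:
  assumes "VectorSpace.subspace class_ring W A"
    and "\<And>x y. \<lbrakk>x \<in> carrier A; y \<in> lower_central A i\<rbrakk> \<Longrightarrow> x \<otimes> y \<in> W"
  shows "lower_central A (Suc i) \<subseteq> W"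
  using span_minimal[OF assms(1), of "{x \<otimes> y | x y. x \<in> carrier A \<and> y \<in> lower_central A i}"]
    assms(2) by auto

lemma lower_central_Suc_subset: "lower_central A (Suc i) \<subseteq> lower_central A i"
proof (induction i)
  case 0
  then show ?case using lower_central_closed by (metis lower_central.simps(1) subsetI)
next
  case (Suc i)
  show ?case
    by (rule lower_central_subset[OF lower_central_subspace])
      (use Suc in \<open>auto intro: mult_mem_lower_central simp del: lower_central.simps\<close>)
qed

text \<open>Polarisation: expand
  \<open>(x \<oplus> y) \<otimes> (x \<oplus> y) = \<zero>\<close>.\<close>

lemma mult_anticommute:
  assumes self: "\<And>x. x \<in> carrier A \<Longrightarrow> x \<otimes> x = \<zero>"
    and x: "x \<in> carrier A" and y: "y \<in> carrier A"
  shows "y \<otimes> x = (-1) \<odot> (x \<otimes> y)"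
proof -
  have "\<zero> = (x \<oplus> y) \<otimes> (x \<oplus> y)" using self x y by simp
  also have "\<dots> = (x \<otimes> y) \<oplus> (y \<otimes> x)"
    using self[OF x] self[OF y] x y
    by (simp add: mult_add_left mult_add_right mult_closed M.a_comm)
  finally have "\<ominus> (x \<otimes> y) = y \<otimes> x"
    using x y by (intro M.minus_equality) (simp_all add: mult_closed M.a_comm)
  then show ?thesis using x y by (simp add: neg_eq_smult mult_closed)
qed

text \<open>The series is defined by multiplication from the left; anticommutativity turns the
  resulting left ideals into two-sided ones.\<close>

lemma lower_central_ideal:
  assumes "\<And>x. x \<in> carrier A \<Longrightarrow> x \<otimes> x = \<zero>"
  shows "algebra_ideal (lower_central A i) A"
proof -
  have *: "x \<otimes> a \<in> lower_central A i" if "x \<in> carrier A" "a \<in> lower_central A i" for x a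
    using mult_mem_lower_central[OF that] lower_central_Suc_subset by blast
  have "a \<otimes> x \<in> lower_central A i" if "x \<in> carrier A" "a \<in> lower_central A i" for x a
    using subspaceD(4)[OF lower_central_subspace *[OF that], of "-1"]
      mult_anticommute[OF assms that(1) lower_central_closed[OF that(2)]] by simp
  with * show ?thesis
    unfolding algebra_ideal_def using lower_central_subspace by blast
qed

lemma carrier_ideal: "algebra_ideal (carrier A) A"
  unfolding algebra_ideal_def by (auto intro!: subspaceI mult_closed)

text \<open>The assumption puts the carrier among the ideals that are intersected, so the
  intersection stays inside the algebra.\<close>

lemma ideal_generated_ideal:
  assumes "S \<subseteq> carrier A"
  shows "algebra_ideal (ideal_generated A S) A"
proof -
  have "VectorSpace.subspace class_ring (ideal_generated A S) A"
    unfolding ideal_generated_def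
  proof (rule subspaceI)
    show "\<Inter> {I. algebra_ideal I A \<and> S \<subseteq> I} \<subseteq> carrier A"
      using carrier_ideal assms by blast
  qed (auto simp: algebra_ideal_def intro: subspaceD)
  then show ?thesis
    by (auto simp: algebra_ideal_def ideal_generated_def)
qed

lemma ideal_generated_superset: "S \<subseteq> ideal_generated A S"
  by (auto simp: ideal_generated_def)

lemma ideal_generated_minimal:
  "\<lbrakk>algebra_ideal I A; S \<subseteq> I\<rbrakk> \<Longrightarrow> ideal_generated A S \<subseteq> I"
  by (auto simp: ideal_generated_def)

end

section \<open>Quotients by an ideal, computed on cosets\<close>

locale complex_algebra_ideal = complex_algebra A for A :: "(complex, 'a) module" (structure) +
  fixes I
  assumes ideal: "algebra_ideal I A"
begin

lemmas ideal_subspace = ideal[unfolded algebra_ideal_def, THEN conjunct1]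
lemmas ideal_subset = subspaceD(1)[OF ideal_subspace]

lemma ideal_mult:
  "\<lbrakk>x \<in> carrier A; a \<in> I\<rbrakk> \<Longrightarrow> x \<otimes> a \<in> I" "\<lbrakk>x \<in> carrier A; a \<in> I\<rbrakk> \<Longrightarrow> a \<otimes> x \<in> I"
  using ideal by (auto simp: algebra_ideal_def)

sublocale abelian_subgroup I A
proof (rule abelian_subgroupI3)
  show "additive_subgroup I A"
  proof (rule additive_subgroupI, rule M.add.subgroupI)
    show "I \<noteq> {}" using subspaceD(2)[OF ideal_subspace] by blast
    show "\<ominus> a \<in> I" if "a \<in> I" for a
      using that subspaceD(4)[OF ideal_subspace] ideal_subset by (auto simp: neg_eq_smult)
  qed (use ideal_subset subspaceD(3)[OF ideal_subspace] in auto)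
qed (rule M.abelian_group_axioms)

lemma coset_eqI:
  "\<lbrakk>a \<in> I; x \<in> carrier A\<rbrakk> \<Longrightarrow> I +> (a \<oplus> x) = I +> x"
  using M.a_coset_add_assoc[OF ideal_subset, of a x] a_rcos_const[of a] ideal_subset by auto

lemma mem_coset: "y \<in> I +> x \<longleftrightarrow> (\<exists>a\<in>I. y = a \<oplus> x)"
  by (auto simp: a_r_coset_def')

lemma quotient_simps:
  "carrier (quotient_algebra A I) = (\<lambda>x. I +> x) ` carrier A"
  "\<zero>\<^bsub>quotient_algebra A I\<^esub> = I"
  "\<lbrakk>x \<in> carrier A; y \<in> carrier A\<rbrakk> \<Longrightarrow> (I +> x) \<oplus>\<^bsub>quotient_algebra A I\<^esub> (I +> y) = I +> (x \<oplus> y)"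
  by (auto simp: quotient_algebra_def A_RCOSETS_def' a_rcos_sum)

text \<open>The scalar action is defined as a union over all representatives of a coset. Each
  representative yields the same coset, so the union is that coset.\<close>

lemma quotient_smult:
  assumes x: "x \<in> carrier A"
  shows "c \<odot>\<^bsub>quotient_algebra A I\<^esub> (I +> x) = I +> (c \<odot> x)"
proof -
  have *: "I +> (c \<odot> y) = I +> (c \<odot> x)" if y: "y \<in> I +> x" for y
  proof -
    obtain a where a: "a \<in> I" "y = a \<oplus> x" using y by (auto simp: mem_coset)
    then have "c \<odot> y = (c \<odot> a) \<oplus> (c \<odot> x)"
      using x ideal_subset by (auto intro: smult_distrib)
    then show ?thesis
      using a x subspaceD(4)[OF ideal_subspace] by (simp add: coset_eqI)
  qed
  have "x \<in> I +> x" by (rule a_rcos_self[OF x])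
  then have "(\<Union>y\<in>I +> x. I +> (c \<odot> y)) = I +> (c \<odot> x)"
    by (intro SUP_eq_const *) auto
  then show ?thesis by (simp add: quotient_algebra_def)
qed

lemma quotient_mult:
  assumes x: "x \<in> carrier A" and y: "y \<in> carrier A"
  shows "(I +> x) \<otimes>\<^bsub>quotient_algebra A I\<^esub> (I +> y) = I +> (x \<otimes> y)"
proof -
  have *: "I +> (x' \<otimes> y') = I +> (x \<otimes> y)" if "x' \<in> I +> x" "y' \<in> I +> y" for x' y'
  proof -
    obtain a b where a: "a \<in> I" "x' = a \<oplus> x" and b: "b \<in> I" "y' = b \<oplus> y"
      using \<open>x' \<in> I +> x\<close> \<open>y' \<in> I +> y\<close> by (auto simp: mem_coset)
    have ab: "a \<in> carrier A" "b \<in> carrier A" using a b ideal_subset by auto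
    \<comment> \<open>All terms of the expanded product except \<open>x \<otimes> y\<close> contain
      a factor from the ideal; hence every pair of representatives yields the same coset, and the
      union defining \<open>rcoset_mult\<close> collapses.\<close>
    have "x' \<otimes> y' = ((a \<otimes> (b \<oplus> y)) \<oplus> (x \<otimes> b)) \<oplus> (x \<otimes> y)"
      using ab x y a b
      by (simp add: mult_add_left mult_add_right mult_closed M.a_ac)
    moreover have "(a \<otimes> (b \<oplus> y)) \<oplus> (x \<otimes> b) \<in> I"
      using a b ab x y by (intro subspaceD(3)[OF ideal_subspace] ideal_mult(1)[OF x]
          ideal_mult(2)) auto
    ultimately show ?thesis
      using x y by (simp add: coset_eqI mult_closed)
  qed
  have ne: "I +> x \<noteq> {}" "I +> y \<noteq> {}" using a_rcos_self[OF x] a_rcos_self[OF y] by auto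
  have "(\<Union>y'\<in>I +> y. I +> (x' \<otimes> y')) = I +> (x \<otimes> y)" if "x' \<in> I +> x" for x'
    by (rule SUP_eq_const[OF ne(2)], rule *[OF that])
  then have "(\<Union>x'\<in>I +> x. \<Union>y'\<in>I +> y. I +> (x' \<otimes> y')) = I +> (x \<otimes> y)"
    by (intro SUP_eq_const[OF ne(1)])
  then show ?thesis by (simp add: quotient_algebra_def rcoset_mult_def)
qed

lemma coset_zero_iff: "x \<in> carrier A \<Longrightarrow> I +> x = I \<longleftrightarrow> x \<in> I"
  using a_rcos_const[of x] a_rcos_self[of x] by auto

lemma quotient_complex_algebra: "complex_algebra (quotient_algebra A I)"
proof -
  have "abelian_group (quotient_algebra A I)"
  proof (rule abelian_groupI)
    have I: "I = I +> \<zero>" using ideal_subset by simp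
    fix X assume "X \<in> carrier (quotient_algebra A I)"
    then obtain x where x: "x \<in> carrier A" "X = I +> x" by (auto simp: quotient_simps)
    show "\<zero>\<^bsub>quotient_algebra A I\<^esub> \<oplus>\<^bsub>quotient_algebra A I\<^esub> X = X"
      using quotient_simps(3)[OF M.zero_closed x(1)] x by (simp add: quotient_simps(2) I[symmetric])
    have "(I +> (\<ominus> x)) \<oplus>\<^bsub>quotient_algebra A I\<^esub> X = \<zero>\<^bsub>quotient_algebra A I\<^esub>"
      using x by (simp add: quotient_simps M.l_neg I[symmetric])
    then show "\<exists>Y\<in>carrier (quotient_algebra A I).
        Y \<oplus>\<^bsub>quotient_algebra A I\<^esub> X = \<zero>\<^bsub>quotient_algebra A I\<^esub>"
      using x by (auto simp: quotient_simps)
  next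
    show "\<zero>\<^bsub>quotient_algebra A I\<^esub> \<in> carrier (quotient_algebra A I)"
      using ideal_subset by (auto simp: quotient_simps intro!: image_eqI[of _ _ \<zero>])
  qed (auto simp: quotient_simps M.a_ac)
  then have vs: "vectorspace (class_ring :: complex ring) (quotient_algebra A I)"
    by (rule complex_vectorspaceI)
      (auto simp: quotient_simps quotient_smult smult_add smult_distrib smult_smult)
  show ?thesis
    unfolding complex_algebra_def complex_algebra_axioms_def
    using vs
    by (auto simp: quotient_simps quotient_smult quotient_mult mult_closed
        mult_add_left mult_add_right mult_smult_left mult_smult_right)
qed

end

section \<open>Homomorphisms to filiform algebras\<close>

definition generates :: "(complex, 'a) module \<Rightarrow> 'a set \<Rightarrow> bool" where
  "generates A S \<longleftrightarrow> S \<subseteq> carrier A \<and>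
     (\<forall>W \<subseteq> carrier A. S \<subseteq> W \<and> \<zero>\<^bsub>A\<^esub> \<in> W \<and> (\<forall>c. \<forall>x \<in> W. c \<odot>\<^bsub>A\<^esub> x \<in> W) \<and>
        (\<forall>x \<in> W. \<forall>y \<in> W. x \<oplus>\<^bsub>A\<^esub> y \<in> W \<and> x \<otimes>\<^bsub>A\<^esub> y \<in> W) \<longrightarrow> W = carrier A)"

text \<open>The elements of the carrier with property \<open>P\<close> form a subset to which the
  minimality in \<open>generates\<close> applies.\<close>

lemma generates_induct [consumes 3, case_names gen zero smult add mult]:
  fixes A (structure)
  assumes "generates A S" "x \<in> carrier A"
    and closed: "complex_algebra A"
    and "\<And>x. x \<in> S \<Longrightarrow> P x" "P \<zero>"
    and "\<And>c x. \<lbrakk>x \<in> carrier A; P x\<rbrakk> \<Longrightarrow> P (c \<odot> x)"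
    and "\<And>x y. \<lbrakk>x \<in> carrier A; y \<in> carrier A; P x; P y\<rbrakk> \<Longrightarrow> P (x \<oplus> y)"
    and "\<And>x y. \<lbrakk>x \<in> carrier A; y \<in> carrier A; P x; P y\<rbrakk> \<Longrightarrow> P (x \<otimes> y)"
  shows "P x"
proof -
  interpret complex_algebra A by (rule closed)
  have "{x \<in> carrier A. P x} = carrier A"
    using assms(1,4-) unfolding generates_def
    by (elim conjE allE[of _ "{x \<in> carrier A. P x}"]) (auto simp: mult_closed)
  then show ?thesis using assms(2) by auto
qed

text \<open>The filiform algebra with basis \<open>X, Y\<^sub>1, \<dots>, Y\<^sub>k\<close> and \<open>[X, Y\<^sub>i] = Y\<^sub>i\<^sub>+\<^sub>1\<close>, in coordinates: index
  \<open>0\<close> is the coefficient of \<open>X\<close> and index \<open>i \<ge> 1\<close> that of \<open>Y\<^sub>i\<close>.\<close>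

definition fil_bracket :: "nat \<Rightarrow> (nat \<Rightarrow> complex) \<Rightarrow> (nat \<Rightarrow> complex) \<Rightarrow> nat \<Rightarrow> complex" where
  "fil_bracket k a b = (\<lambda>i. if 2 \<le> i \<and> i \<le> k then a 0 * b (i - 1) - b 0 * a (i - 1) else 0)"

text \<open>In the basis of the filiform algebra this is the element \<open>\<alpha> v\<close> X +
  \<open>\<beta> v\<close> \<open>Y\<^sub>1\<close>.\<close>

definition fil_gen :: "('v \<Rightarrow> complex) \<Rightarrow> ('v \<Rightarrow> complex) \<Rightarrow> 'v \<Rightarrow> nat \<Rightarrow> complex" where
  "fil_gen \<alpha> \<beta> v = (\<lambda>i. if i = 0 then \<alpha> v else if i = 1 then \<beta> v else 0)"

text \<open>The target is the type of all coordinate sequences instead of an algebra record, so a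
  homomorphism is described by equations between coordinates.\<close>

definition fil_hom :: "nat \<Rightarrow> (complex, 'a) module \<Rightarrow> ('a \<Rightarrow> nat \<Rightarrow> complex) \<Rightarrow> bool" where
  "fil_hom k A F \<longleftrightarrow>
     (\<forall>x \<in> carrier A. \<forall>y \<in> carrier A. F (x \<oplus>\<^bsub>A\<^esub> y) = (\<lambda>i. F x i + F y i) \<and>
        F (x \<otimes>\<^bsub>A\<^esub> y) = fil_bracket k (F x) (F y)) \<and>
     (\<forall>c. \<forall>x \<in> carrier A. F (c \<odot>\<^bsub>A\<^esub> x) = (\<lambda>i. c * F x i))"

lemma fil_homD:
  assumes "fil_hom k A F" "x \<in> carrier A"
  shows "F (c \<odot>\<^bsub>A\<^esub> x) = (\<lambda>i. c * F x i)"
    and "y \<in> carrier A \<Longrightarrow> F (x \<oplus>\<^bsub>A\<^esub> y) = (\<lambda>i. F x i + F y i)"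
    and "y \<in> carrier A \<Longrightarrow> F (x \<otimes>\<^bsub>A\<^esub> y) = fil_bracket k (F x) (F y)"
  using assms by (auto simp: fil_hom_def)

lemma fil_bracket_0 [simp]:
  "fil_bracket k a (\<lambda>_. 0) = (\<lambda>_. 0)" "fil_bracket k (\<lambda>_. 0) a = (\<lambda>_. 0)"
  by (auto simp: fil_bracket_def)

section \<open>Kernels of filiform homomorphisms and descent to quotients\<close>

context complex_algebra
begin

lemma fil_hom_zero:
  assumes "fil_hom k A F"
  shows "F \<zero> = (\<lambda>_. 0)"
  using fil_homD(1)[OF assms, of \<zero> 0] by simp

lemma fil_hom_kernel_ideal:
  assumes F: "fil_hom k A F"
  shows "algebra_ideal {x \<in> carrier A. F x = (\<lambda>_. 0)} A"
  unfolding algebra_ideal_def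
  using F fil_hom_zero[OF F]
  by (auto intro!: subspaceI simp: fil_homD mult_closed)

lemma fil_hom_ideal_generated:
  assumes F: "fil_hom k A F" and S: "S \<subseteq> carrier A" "\<And>x. x \<in> S \<Longrightarrow> F x = (\<lambda>_. 0)"
    and x: "x \<in> ideal_generated A S"
  shows "F x = (\<lambda>_. 0)"
  using ideal_generated_minimal[OF fil_hom_kernel_ideal[OF F], of S] S x by auto

text \<open>The filiform bracket is alternating and satisfies Jacobi: brackets have coordinate 0
  equal to zero, so a double bracket of a, b, c has the coordinates
  \<open>a 0 * (b 0 * c (i - 2) - c 0 * b (i - 2))\<close>, whose cyclic sum cancels.\<close>

lemma fil_hom_lie_relators:
  assumes F: "fil_hom k A F" and x: "x \<in> lie_relators A"
  shows "F x = (\<lambda>_. 0)"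
  using x F unfolding lie_relators_def
  by (auto simp: fil_homD mult_closed fil_bracket_def fun_eq_iff algebra_simps)

text \<open>Each further bracket shifts the Y-coordinates up by one, so the image lies in the span
  of \<open>Y\<^sub>i\<close> with j + 2 \<le> i \<le> k. For j = k - 1 this leaves nothing, which
  is how the homomorphism passes to the k-step nilpotent quotient.\<close>

lemma fil_hom_lower_central:
  assumes F: "fil_hom k A F" and "x \<in> lower_central A (Suc j)" and i: "i \<le> Suc j \<or> k < i"
  shows "F x i = 0"
proof -
  let ?W = "\<lambda>j. {x \<in> carrier A. \<forall>i. i \<le> Suc j \<or> k < i \<longrightarrow> F x i = 0}"
  have sub: "VectorSpace.subspace class_ring (?W j) A" for j
    by (auto intro!: subspaceI simp: fil_homD[OF F] fil_hom_zero[OF F])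
  have "lower_central A (Suc j) \<subseteq> ?W j" for j
  proof (induction j)
    case 0
    show ?case
      by (rule lower_central_subset[OF sub])
        (auto simp: fil_homD[OF F] fil_bracket_def mult_closed)
  next
    case (Suc j)
    show ?case
    proof (rule lower_central_subset[OF sub])
      fix x y assume "x \<in> carrier A" and y: "y \<in> lower_central A (Suc j)"
      moreover have "y \<in> ?W j" using y Suc by blast
      ultimately show "x \<otimes> y \<in> ?W (Suc j)"
        by (auto simp: fil_homD[OF F] fil_bracket_def mult_closed)
    qed
  qed
  then show ?thesis using assms by blast
qed

lemma lie_relators_closed: "lie_relators A \<subseteq> carrier A"
  unfolding lie_relators_def by (auto simp: mult_closed)

end

context complex_algebra_ideal
begin

lemma generates_quotient:
  assumes S: "generates A S"
  shows "generates (quotient_algebra A I) ((+>) I ` S)"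
  unfolding generates_def
proof (intro conjI allI impI; (elim conjE)?)
  show "(+>) I ` S \<subseteq> carrier (quotient_algebra A I)"
    using S by (auto simp: generates_def quotient_simps)
  fix W
  assume W: "W \<subseteq> carrier (quotient_algebra A I)" "(+>) I ` S \<subseteq> W"
    "\<zero>\<^bsub>quotient_algebra A I\<^esub> \<in> W" "\<forall>c. \<forall>x\<in>W. c \<odot>\<^bsub>quotient_algebra A I\<^esub> x \<in> W"
    "\<forall>x\<in>W. \<forall>y\<in>W. x \<oplus>\<^bsub>quotient_algebra A I\<^esub> y \<in> W \<and> x \<otimes>\<^bsub>quotient_algebra A I\<^esub> y \<in> W"
  have "I +> x \<in> W" if "x \<in> carrier A" for x
    using S that complex_algebra_axioms
  proof (induction rule: generates_induct)
    case (smult c x)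
    then show ?case using W(4) quotient_smult by metis
  next
    case (add x y)
    then show ?case using W(5) quotient_simps(3) by metis
  next
    case (mult x y)
    then show ?case using W(5) quotient_mult by metis
  qed (use W ideal_subset in \<open>auto simp: quotient_simps\<close>)
  then show "W = carrier (quotient_algebra A I)"
    using W(1) by (auto simp: quotient_simps)
qed

text \<open>A homomorphism that kills the ideal factors through the quotient. The representative
  taken by \<open>SOME\<close> is immaterial, since two of them differ by an element on which
  \<open>F\<close> vanishes.\<close>

lemma fil_hom_quotient:
  assumes F: "fil_hom k A F" and ker: "\<And>x. x \<in> I \<Longrightarrow> F x = (\<lambda>_. 0)"
  obtains G where "fil_hom k (quotient_algebra A I) G" "\<And>x. x \<in> carrier A \<Longrightarrow> G (I +> x) = F x"
proof -
  define G where "G X = F (SOME x. x \<in> carrier A \<and> I +> x = X)" for X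
  have G: "G (I +> x) = F x" if x: "x \<in> carrier A" for x
  proof -
    define y where "y = (SOME y. y \<in> carrier A \<and> I +> y = I +> x)"
    have y: "y \<in> carrier A" "I +> y = I +> x"
      using someI[of "\<lambda>y. y \<in> carrier A \<and> I +> y = I +> x" x] x by (auto simp: y_def)
    then obtain a where "a \<in> I" "y = a \<oplus> x" using a_rcos_self[of y] mem_coset by auto
    then have "F y = F x" using ker[of a] fil_homD(2)[OF F, of a x] x ideal_subset by auto
    then show ?thesis by (simp add: G_def y_def)
  qed
  have "fil_hom k (quotient_algebra A I) G"
    unfolding fil_hom_def
    by (auto simp: quotient_simps quotient_smult quotient_mult G fil_homD[OF F] mult_closed)
  then show ?thesis using that G by blast
qed

end

section \<open>The free nonassociative algebra and its filiform homomorphisms\<close>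

lemma magma_carrierD:
  "f \<in> carrier (magma_algebra V) \<Longrightarrow> finite {w. f w \<noteq> 0}"
  "f \<in> carrier (magma_algebra V) \<Longrightarrow> f w \<noteq> 0 \<Longrightarrow> vertices w \<subseteq> V"
  by (auto simp: magma_algebra_def)

text \<open>Words factor uniquely. The formula gives finiteness of the support of a product and
  later reindexes sums over it by pairs of words.\<close>

lemma magma_mult_support:
  "{w. magma_mult f g w \<noteq> 0} = (\<lambda>(s, t). Prod s t) ` ({w. f w \<noteq> 0} \<times> {w. g w \<noteq> 0})"
  (is "?L = ?R")
proof -
  have "w \<in> ?L \<longleftrightarrow> w \<in> ?R" for w by (cases w) auto
  then show ?thesis by blast
qed

lemma magma_mult_closed:
  assumes "f \<in> carrier (magma_algebra V)" "g \<in> carrier (magma_algebra V)"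
  shows "magma_mult f g \<in> carrier (magma_algebra V)"
proof -
  have "vertices w \<subseteq> V" if "magma_mult f g w \<noteq> 0" for w
    using that magma_carrierD(2)[OF assms(1)] magma_carrierD(2)[OF assms(2)]
    by (cases w) auto
  moreover have "finite {w. magma_mult f g w \<noteq> 0}"
    unfolding magma_mult_support using magma_carrierD(1) assms by blast
  ultimately show ?thesis by (auto simp: magma_algebra_def)
qed

lemma magma_add_closed:
  assumes "f \<in> carrier (magma_algebra V)" "g \<in> carrier (magma_algebra V)"
  shows "(\<lambda>w. f w + g w) \<in> carrier (magma_algebra V)"
proof -
  have "finite {w. f w + g w \<noteq> 0}"
    by (rule finite_subset[of _ "{w. f w \<noteq> 0} \<union> {w. g w \<noteq> 0}"])
      (use magma_carrierD(1)[OF assms(1)] magma_carrierD(1)[OF assms(2)] in auto)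
  moreover have "vertices w \<subseteq> V" if "f w + g w \<noteq> 0" for w
    using that magma_carrierD(2)[OF assms(1), of w] magma_carrierD(2)[OF assms(2), of w]
    by (cases "f w = 0") auto
  ultimately show ?thesis by (auto simp: magma_algebra_def)
qed

lemma magma_smult_closed:
  assumes "f \<in> carrier (magma_algebra V)"
  shows "(\<lambda>w. c * f w) \<in> carrier (magma_algebra V)"
proof -
  have "finite {w. c * f w \<noteq> 0}"
    by (rule finite_subset[OF _ magma_carrierD(1)[OF assms]]) auto
  then show ?thesis using assms by (auto simp: magma_algebra_def)
qed

lemma magma_algebra_simps:
  "mult (magma_algebra V) = magma_mult" "zero (magma_algebra V) = (\<lambda>w. 0)"
  "add (magma_algebra V) = (\<lambda>f g w. f w + g w)" "smult (magma_algebra V) = (\<lambda>c f w. c * f w)"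
  by (simp_all add: magma_algebra_def)

lemma magma_zero_closed: "(\<lambda>w. 0) \<in> carrier (magma_algebra V)"
  by (simp add: magma_algebra_def)

lemma complex_algebra_magma: "complex_algebra (magma_algebra V)"
proof -
  note simps = magma_algebra_simps
  note closed = magma_add_closed magma_smult_closed magma_mult_closed magma_zero_closed
  have "abelian_group (magma_algebra V)"
  proof (rule abelian_groupI)
    fix f assume "f \<in> carrier (magma_algebra V)"
    then show "\<exists>g\<in>carrier (magma_algebra V).
        g \<oplus>\<^bsub>magma_algebra V\<^esub> f = \<zero>\<^bsub>magma_algebra V\<^esub>"
      by (intro bexI[of _ "\<lambda>w. (-1) * f w"]) (auto simp only: closed, auto simp: simps)
  qed (auto simp: simps closed algebra_simps)
  then have "vectorspace (class_ring :: complex ring) (magma_algebra V)"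
    by (rule complex_vectorspaceI) (auto simp: simps closed algebra_simps)
  moreover have "complex_algebra_axioms (magma_algebra V)"
  proof (unfold_locales, goal_cases)
    case (2 f g h) show ?case
      by (rule ext, rename_tac w, case_tac w) (auto simp: simps algebra_simps)
  next
    case (3 f g h) show ?case
      by (rule ext, rename_tac w, case_tac w) (auto simp: simps algebra_simps)
  next
    case (4 f g c) show ?case
      by (rule ext, rename_tac w, case_tac w) (auto simp: simps algebra_simps)
  next
    case (5 f g c) show ?case
      by (rule ext, rename_tac w, case_tac w) (auto simp: simps algebra_simps)
  qed (auto simp: simps closed)
  ultimately show ?thesis by (simp add: complex_algebra_def)
qed

abbreviation word :: "'v magma \<Rightarrow> 'v magma \<Rightarrow> complex" where
  "word u \<equiv> (\<lambda>w. if w = u then 1 else 0)"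

lemma word_closed: "word u \<in> carrier (magma_algebra V) \<longleftrightarrow> vertices u \<subseteq> V"
  by (auto simp: magma_algebra_def)

lemma magma_mult_word: "magma_mult (word s) (word t) = word (Prod s t)"
  by (rule ext, rename_tac w, case_tac w) auto

lemma generates_magma: "generates (magma_algebra V) ((\<lambda>v. word (Gen v)) ` V)"
  unfolding generates_def
proof (intro conjI allI impI; (elim conjE)?)
  show "(\<lambda>v. word (Gen v)) ` V \<subseteq> carrier (magma_algebra V)"
    by (auto simp: word_closed)
  fix W
  assume W: "W \<subseteq> carrier (magma_algebra V)" "(\<lambda>v. word (Gen v)) ` V \<subseteq> W"
    "\<zero>\<^bsub>magma_algebra V\<^esub> \<in> W" "\<forall>c. \<forall>x\<in>W. c \<odot>\<^bsub>magma_algebra V\<^esub> x \<in> W"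
    "\<forall>x\<in>W. \<forall>y\<in>W. x \<oplus>\<^bsub>magma_algebra V\<^esub> y \<in> W \<and> x \<otimes>\<^bsub>magma_algebra V\<^esub> y \<in> W"
  have word: "word u \<in> W" if "vertices u \<subseteq> V" for u
    using that
  proof (induction u)
    case (Prod s t)
    then have "word s \<otimes>\<^bsub>magma_algebra V\<^esub> word t \<in> W" using W(5) by auto
    then show ?case by (simp add: magma_algebra_simps magma_mult_word)
  qed (use W in auto)
  \<comment> \<open>Induction on a finite set containing the support: the word \<open>u\<close> is
    split off, and \<open>g\<close> is what remains of \<open>f\<close>.\<close>
  have "f \<in> W" if "finite T" "f \<in> carrier (magma_algebra V)" "{w. f w \<noteq> 0} \<subseteq> T" for f T
    using that
  proof (induction T arbitrary: f rule: finite_induct)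
    case empty
    then have "f = (\<lambda>_. 0)" by auto
    then show ?case using W(3) by (simp add: magma_algebra_simps)
  next
    case (insert u T)
    define g where "g = (\<lambda>w. if w = u then 0 else f w)"
    have "finite {w. g w \<noteq> 0}"
      by (rule finite_subset[OF _ magma_carrierD(1)[OF insert.prems(1)]]) (auto simp: g_def)
    then have "g \<in> carrier (magma_algebra V)"
      using magma_carrierD[OF insert.prems(1)] by (auto simp: g_def magma_algebra_def)
    then have g: "g \<in> W" using insert.prems(2) by (intro insert.IH) (auto simp: g_def)
    show ?case
    proof (cases "f u = 0")
      case True
      then have "f = g" by (auto simp: g_def)
      then show ?thesis using g by simp
    next
      case False
      then have "word u \<in> W" using word magma_carrierD(2)[OF insert.prems(1)] by blast
      then have "f u \<odot>\<^bsub>magma_algebra V\<^esub> word u \<oplus>\<^bsub>magma_algebra V\<^esub> g \<in> W"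
        using W(4,5) g by blast
      moreover have "f u \<odot>\<^bsub>magma_algebra V\<^esub> word u \<oplus>\<^bsub>magma_algebra V\<^esub> g = f"
        by (auto simp: magma_algebra_simps g_def)
      ultimately show ?thesis by simp
    qed
  qed
  then show "W = carrier (magma_algebra V)"
    using W(1) magma_carrierD(1) by blast
qed

text \<open>Evaluation of a word in the filiform algebra after substituting
  \<open>fil_gen \<alpha> \<beta> v\<close> for each letter \<open>v\<close>; the homomorphism on
  the free algebra is its linear extension.\<close>

primrec fil_word ::
  "nat \<Rightarrow> ('v \<Rightarrow> complex) \<Rightarrow> ('v \<Rightarrow> complex) \<Rightarrow> 'v magma \<Rightarrow> nat \<Rightarrow> complex" where
  "fil_word k \<alpha> \<beta> (Gen v) = fil_gen \<alpha> \<beta> v"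
| "fil_word k \<alpha> \<beta> (Prod s t) = fil_bracket k (fil_word k \<alpha> \<beta> s) (fil_word k \<alpha> \<beta> t)"

lemma fil_hom_magma:
  obtains F where "fil_hom k (magma_algebra V) F" "\<And>v. v \<in> V \<Longrightarrow> F (word (Gen v)) = fil_gen \<alpha> \<beta> v"
proof -
  let ?e = "fil_word k \<alpha> \<beta>"
  define F where "F f = (\<lambda>i. \<Sum>w | f w \<noteq> 0. f w * ?e w i)" for f
  \<comment> \<open>The sum may run over any finite set containing the support, so the values at
    different functions can be compared over one index set.\<close>
  have F: "F f i = (\<Sum>w\<in>T. f w * ?e w i)" if "finite T" "{w. f w \<noteq> 0} \<subseteq> T" for f T i
    unfolding F_def using that by (intro sum.mono_neutral_left) auto
  have "fil_hom k (magma_algebra V) F"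
    unfolding fil_hom_def magma_algebra_simps
  proof (intro conjI ballI allI)
    fix f g assume fg: "f \<in> carrier (magma_algebra V)" "g \<in> carrier (magma_algebra V)"
    let ?S = "{w. f w \<noteq> 0}" and ?T = "{w. g w \<noteq> 0}"
    have fin: "finite ?S" "finite ?T" using fg magma_carrierD(1) by blast+
    show "F (\<lambda>w. f w + g w) = (\<lambda>i. F f i + F g i)"
    proof
      fix i
      have "F (\<lambda>w. f w + g w) i = (\<Sum>w\<in>?S \<union> ?T. (f w + g w) * ?e w i)"
        using fin by (intro F) auto
      also have "\<dots> = F f i + F g i"
        using F[of "?S \<union> ?T" f i] F[of "?S \<union> ?T" g i] fin
        by (simp add: distrib_right sum.distrib)
      finally show "F (\<lambda>w. f w + g w) i = F f i + F g i" .
    qed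
    show "F (magma_mult f g) = fil_bracket k (F f) (F g)"
    proof
      fix i
      \<comment> \<open>By unique factorisation the support of the product is indexed by pairs of
        words; multiplicativity then becomes bilinearity of \<open>fil_bracket\<close>.\<close>
      have inj: "inj_on (\<lambda>(s, t). Prod s t) (?S \<times> ?T)" by (auto simp: inj_on_def)
      have "F (magma_mult f g) i = (\<Sum>(s, t)\<in>?S \<times> ?T. f s * g t * fil_bracket k (?e s) (?e t) i)"
        unfolding F_def magma_mult_support
        by (subst sum.reindex[OF inj]) (auto simp: case_prod_unfold)
      also have "\<dots> = (\<Sum>s\<in>?S. \<Sum>t\<in>?T. f s * g t * fil_bracket k (?e s) (?e t) i)"
        by (simp add: sum.cartesian_product)
      also have "\<dots> = fil_bracket k (F f) (F g) i"
      proof (cases "2 \<le> i \<and> i \<le> k")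
        case True
        have "(\<Sum>s\<in>?S. \<Sum>t\<in>?T. f s * g t * fil_bracket k (?e s) (?e t) i) =
            (\<Sum>s\<in>?S. \<Sum>t\<in>?T. (f s * ?e s 0) * (g t * ?e t (i - 1))) -
            (\<Sum>s\<in>?S. \<Sum>t\<in>?T. (f s * ?e s (i - 1)) * (g t * ?e t 0))"
          using True by (simp add: fil_bracket_def sum_subtractf[symmetric] algebra_simps)
        also have "\<dots> = fil_bracket k (F f) (F g) i"
          using True by (simp add: fil_bracket_def F_def sum_product)
            (subst sum.swap, simp add: mult.commute)
        finally show ?thesis .
      next
        case False
        then show ?thesis by (auto simp: fil_bracket_def)
      qed
      finally show "F (magma_mult f g) i = fil_bracket k (F f) (F g) i" .
    qed
  next
    fix c f assume "f \<in> carrier (magma_algebra V)"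
    then have "finite {w. f w \<noteq> 0}" by (rule magma_carrierD)
    then show "F (\<lambda>w. c * f w) = (\<lambda>i. c * F f i)"
      by (intro ext, subst F[of "{w. f w \<noteq> 0}"]) (auto simp: F_def sum_distrib_left mult.assoc)
  qed
  moreover have "F (word (Gen v)) = fil_gen \<alpha> \<beta> v" for v
    by (simp add: F_def)
  ultimately show ?thesis using that by blast
qed

section \<open>Graph Lie algebras by generators and relations\<close>

text \<open>Of the universal property of the graph Lie algebra only the homomorphisms to the filiform
  algebra with values in the span of \<open>X\<close> and \<open>Y\<^sub>1\<close> on the generators are needed. The condition on
  \<open>\<alpha>\<close> and \<open>\<beta>\<close> says that the images of non-adjacent vertices commute.\<close>

definition graph_presented ::
  "nat \<Rightarrow> 'v set \<Rightarrow> 'v set set \<Rightarrow> (complex, 'a) module \<Rightarrow> ('v \<Rightarrow> 'a) \<Rightarrow> bool" where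
  "graph_presented k V E A g \<longleftrightarrow> generates A (g ` V) \<and>
     (\<forall>u \<in> V. \<forall>w \<in> V. u \<noteq> w \<longrightarrow> {u, w} \<notin> E \<longrightarrow> g u \<otimes>\<^bsub>A\<^esub> g w = \<zero>\<^bsub>A\<^esub>) \<and>
     (\<forall>\<alpha> \<beta>. (\<forall>u \<in> V. \<forall>w \<in> V. u \<noteq> w \<longrightarrow> {u, w} \<notin> E \<longrightarrow> \<alpha> u * \<beta> w = \<alpha> w * \<beta> u) \<longrightarrow>
        (\<exists>F. fil_hom k A F \<and> (\<forall>v \<in> V. F (g v) = fil_gen \<alpha> \<beta> v)))"

lemma graph_presentedD:
  assumes "graph_presented k V E A g"
  shows "generates A (g ` V)"
    and "\<lbrakk>u \<in> V; w \<in> V; u \<noteq> w; {u, w} \<notin> E\<rbrakk> \<Longrightarrow> g u \<otimes>\<^bsub>A\<^esub> g w = \<zero>\<^bsub>A\<^esub>"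
    and "(\<And>u w. \<lbrakk>u \<in> V; w \<in> V; u \<noteq> w; {u, w} \<notin> E\<rbrakk> \<Longrightarrow> \<alpha> u * \<beta> w = \<alpha> w * \<beta> u)
      \<Longrightarrow> \<exists>F. fil_hom k A F \<and> (\<forall>v \<in> V. F (g v) = fil_gen \<alpha> \<beta> v)"
proof -
  show "generates A (g ` V)"
    and "\<lbrakk>u \<in> V; w \<in> V; u \<noteq> w; {u, w} \<notin> E\<rbrakk> \<Longrightarrow> g u \<otimes>\<^bsub>A\<^esub> g w = \<zero>\<^bsub>A\<^esub>"
    using assms unfolding graph_presented_def by simp_all
  assume "\<And>u w. \<lbrakk>u \<in> V; w \<in> V; u \<noteq> w; {u, w} \<notin> E\<rbrakk> \<Longrightarrow> \<alpha> u * \<beta> w = \<alpha> w * \<beta> u"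
  then show "\<exists>F. fil_hom k A F \<and> (\<forall>v \<in> V. F (g v) = fil_gen \<alpha> \<beta> v)"
    using assms[unfolded graph_presented_def, THEN conjunct2, THEN conjunct2,
        THEN spec[of _ \<alpha>], THEN spec[of _ \<beta>]] by blast
qed

lemma graph_presentedI:
  assumes "generates A (g ` V)"
    and "\<And>u w. \<lbrakk>u \<in> V; w \<in> V; u \<noteq> w; {u, w} \<notin> E\<rbrakk> \<Longrightarrow> g u \<otimes>\<^bsub>A\<^esub> g w = \<zero>\<^bsub>A\<^esub>"
    and "\<And>\<alpha> \<beta>. \<forall>u \<in> V. \<forall>w \<in> V. u \<noteq> w \<longrightarrow> {u, w} \<notin> E \<longrightarrow> \<alpha> u * \<beta> w = \<alpha> w * \<beta> u
      \<Longrightarrow> \<exists>F. fil_hom k A F \<and> (\<forall>v \<in> V. F (g v) = fil_gen \<alpha> \<beta> v)"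
  shows "graph_presented k V E A g"
  using assms unfolding graph_presented_def by simp

text \<open>Squares belong to the relators, and a homomorphism to the filiform algebra kills every
  relator, hence descends from the free nonassociative algebra.\<close>

lemma free_lie:
  "complex_algebra (free_lie_algebra V)"
  "generates (free_lie_algebra V) (free_lie_gen V ` V)"
  "x \<in> carrier (free_lie_algebra V) \<Longrightarrow> x \<otimes>\<^bsub>free_lie_algebra V\<^esub> x = \<zero>\<^bsub>free_lie_algebra V\<^esub>"
  "\<exists>F. fil_hom k (free_lie_algebra V) F \<and> (\<forall>v \<in> V. F (free_lie_gen V v) = fil_gen \<alpha> \<beta> v)"
proof -
  interpret M: complex_algebra "magma_algebra V" by (rule complex_algebra_magma)
  interpret complex_algebra_ideal "magma_algebra V" "lie_relation_ideal V"
    by unfold_locales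
      (use M.ideal_generated_ideal[OF M.lie_relators_closed] in \<open>simp add: lie_relation_ideal_def\<close>)
  have gen: "free_lie_gen V ` V = (+>\<^bsub>magma_algebra V\<^esub>) (lie_relation_ideal V) ` (\<lambda>v. word (Gen v)) ` V"
    by (simp add: free_lie_gen_def image_image)
  show "complex_algebra (free_lie_algebra V)"
    unfolding free_lie_algebra_def by (rule quotient_complex_algebra)
  show "generates (free_lie_algebra V) (free_lie_gen V ` V)"
    unfolding free_lie_algebra_def gen by (rule generates_quotient[OF generates_magma])
  show "x \<otimes>\<^bsub>free_lie_algebra V\<^esub> x = \<zero>\<^bsub>free_lie_algebra V\<^esub>" if x: "x \<in> carrier (free_lie_algebra V)" for x
  proof -
    obtain f where f: "f \<in> carrier (magma_algebra V)" "x = lie_relation_ideal V +>\<^bsub>magma_algebra V\<^esub> f"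
      using x by (auto simp: free_lie_algebra_def quotient_simps)
    have "f \<otimes>\<^bsub>magma_algebra V\<^esub> f \<in> lie_relators (magma_algebra V)"
      using f by (auto simp: lie_relators_def)
    then have "f \<otimes>\<^bsub>magma_algebra V\<^esub> f \<in> lie_relation_ideal V"
      unfolding lie_relation_ideal_def using M.ideal_generated_superset by blast
    then show ?thesis
      using f by (simp add: free_lie_algebra_def quotient_mult quotient_simps(2) coset_zero_iff M.mult_closed)
  qed
  show "\<exists>F. fil_hom k (free_lie_algebra V) F \<and> (\<forall>v \<in> V. F (free_lie_gen V v) = fil_gen \<alpha> \<beta> v)"
  proof -
    obtain F where F: "fil_hom k (magma_algebra V) F"
      and Fg: "\<And>v. v \<in> V \<Longrightarrow> F (word (Gen v)) = fil_gen \<alpha> \<beta> v"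
      using fil_hom_magma[where k = k and V = V and \<alpha> = \<alpha> and \<beta> = \<beta>] by blast
    have "F x = (\<lambda>_. 0)" if "x \<in> lie_relation_ideal V" for x
      using M.fil_hom_ideal_generated[OF F M.lie_relators_closed] M.fil_hom_lie_relators[OF F] that
      by (auto simp: lie_relation_ideal_def)
    then obtain G where G: "fil_hom k (free_lie_algebra V) G"
      "\<And>x. x \<in> carrier (magma_algebra V) \<Longrightarrow> G (lie_relation_ideal V +>\<^bsub>magma_algebra V\<^esub> x) = F x"
      using fil_hom_quotient[OF F] unfolding free_lie_algebra_def by metis
    have "G (free_lie_gen V v) = fil_gen \<alpha> \<beta> v" if "v \<in> V" for v
      using that G(2)[of "word (Gen v)"] Fg by (simp add: free_lie_gen_def word_closed)
    then show ?thesis using G(1) by blast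
  qed
qed

lemma free_nilpotent_lie:
  assumes k: "k \<ge> 1"
  shows "complex_algebra (free_nilpotent_lie_algebra k V)"
    and "generates (free_nilpotent_lie_algebra k V) (free_nilpotent_gen k V ` V)"
    and "\<exists>F. fil_hom k (free_nilpotent_lie_algebra k V) F \<and>
      (\<forall>v \<in> V. F (free_nilpotent_gen k V v) = fil_gen \<alpha> \<beta> v)"
proof -
  let ?L = "free_lie_algebra V"
  interpret L: complex_algebra ?L by (rule free_lie)
  interpret complex_algebra_ideal ?L "lower_central ?L k"
    by unfold_locales (rule L.lower_central_ideal, rule free_lie(3))
  have gen: "free_nilpotent_gen k V ` V = (+>\<^bsub>?L\<^esub>) (lower_central ?L k) ` free_lie_gen V ` V"
    by (simp add: free_nilpotent_gen_def image_image)
  show "complex_algebra (free_nilpotent_lie_algebra k V)"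
    unfolding free_nilpotent_lie_algebra_def by (rule quotient_complex_algebra)
  show "generates (free_nilpotent_lie_algebra k V) (free_nilpotent_gen k V ` V)"
    unfolding free_nilpotent_lie_algebra_def gen by (rule generates_quotient[OF free_lie(2)])
  show "\<exists>F. fil_hom k (free_nilpotent_lie_algebra k V) F \<and>
      (\<forall>v \<in> V. F (free_nilpotent_gen k V v) = fil_gen \<alpha> \<beta> v)"
  proof -
    obtain F where F: "fil_hom k ?L F" and Fg: "\<forall>v \<in> V. F (free_lie_gen V v) = fil_gen \<alpha> \<beta> v"
      using free_lie(4)[where k = k and V = V and \<alpha> = \<alpha> and \<beta> = \<beta>] by blast
    \<comment> \<open>With j = k - 1 the two alternatives i \<le> k and k < i exhaust all
      coordinates. Here k \<ge> 1 matters: at index 0 the series is still the whole algebra.\<close>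
    have "F x = (\<lambda>_. 0)" if "x \<in> lower_central ?L k" for x
      using L.fil_hom_lower_central[OF F, of x "k - 1"] k that by (simp add: fun_eq_iff) (meson not_le)
    then obtain G where G: "fil_hom k (free_nilpotent_lie_algebra k V) G"
      "\<And>x. x \<in> carrier ?L \<Longrightarrow> G (lower_central ?L k +>\<^bsub>?L\<^esub> x) = F x"
      using fil_hom_quotient[OF F] unfolding free_nilpotent_lie_algebra_def by metis
    have "G (free_nilpotent_gen k V v) = fil_gen \<alpha> \<beta> v" if "v \<in> V" for v
      using that G(2)[of "free_lie_gen V v"] Fg free_lie(2)[of V]
      by (auto simp: free_nilpotent_gen_def generates_def)
    then show ?thesis using G(1) by blast
  qed
qed

lemma graph_lie:
  assumes k: "k \<ge> 1"
  shows "complex_algebra (graph_lie_algebra k V E)"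
    and "graph_presented k V E (graph_lie_algebra k V E)
      (\<lambda>v. graph_ideal k V E +>\<^bsub>free_nilpotent_lie_algebra k V\<^esub> free_nilpotent_gen k V v)"
proof -
  let ?N = "free_nilpotent_lie_algebra k V" and ?x = "free_nilpotent_gen k V"
  let ?R = "{?x u \<otimes>\<^bsub>?N\<^esub> ?x v | u v. u \<in> V \<and> v \<in> V \<and> u \<noteq> v \<and> {u, v} \<notin> E}"
  interpret N: complex_algebra ?N by (rule free_nilpotent_lie[OF k])
  have gen: "generates ?N (?x ` V)" by (rule free_nilpotent_lie[OF k])
  then have x: "?x v \<in> carrier ?N" if "v \<in> V" for v using that by (auto simp: generates_def)
  have R: "?R \<subseteq> carrier ?N" using x by (auto simp: N.mult_closed)
  interpret complex_algebra_ideal ?N "graph_ideal k V E"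
    by unfold_locales (use N.ideal_generated_ideal[OF R] in \<open>simp add: graph_ideal_def\<close>)
  show "complex_algebra (graph_lie_algebra k V E)"
    unfolding graph_lie_algebra_def by (rule quotient_complex_algebra)
  show "graph_presented k V E (graph_lie_algebra k V E) (\<lambda>v. graph_ideal k V E +>\<^bsub>?N\<^esub> ?x v)"
  proof (rule graph_presentedI)
    show "generates (graph_lie_algebra k V E) ((\<lambda>v. graph_ideal k V E +>\<^bsub>?N\<^esub> ?x v) ` V)"
      using generates_quotient[OF gen] by (simp add: graph_lie_algebra_def image_image)
    fix u w assume uw: "u \<in> V" "w \<in> V" "u \<noteq> w" "{u, w} \<notin> E"
    then have "?x u \<otimes>\<^bsub>?N\<^esub> ?x w \<in> graph_ideal k V E"
      unfolding graph_ideal_def using N.ideal_generated_superset[of ?R] by blast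
    then show "(graph_ideal k V E +>\<^bsub>?N\<^esub> ?x u) \<otimes>\<^bsub>graph_lie_algebra k V E\<^esub>
        (graph_ideal k V E +>\<^bsub>?N\<^esub> ?x w) = \<zero>\<^bsub>graph_lie_algebra k V E\<^esub>"
      using uw x
      by (simp add: graph_lie_algebra_def quotient_mult quotient_simps(2) coset_zero_iff N.mult_closed)
  next
    fix \<alpha> \<beta> :: "'a \<Rightarrow> complex"
    assume ab: "\<forall>u\<in>V. \<forall>w\<in>V. u \<noteq> w \<longrightarrow> {u, w} \<notin> E \<longrightarrow> \<alpha> u * \<beta> w = \<alpha> w * \<beta> u"
    obtain F where F: "fil_hom k ?N F" and Fx: "\<forall>v \<in> V. F (?x v) = fil_gen \<alpha> \<beta> v"
      using free_nilpotent_lie(3)[OF k, where V = V and \<alpha> = \<alpha> and \<beta> = \<beta>] by blast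
    \<comment> \<open>The images of \<open>u\<close> and \<open>w\<close> have bracket
      (\<open>\<alpha> u * \<beta> w - \<alpha> w * \<beta> u\<close>) \<open>Y\<^sub>2\<close> (or
      zero when k < 2), and this vanishes for non-adjacent vertices by the condition on
      \<open>\<alpha>\<close> and \<open>\<beta>\<close>.\<close>
    have "F y = (\<lambda>_. 0)" if "y \<in> ?R" for y
      using that ab x Fx
      by (auto simp: fil_homD(3)[OF F] fil_bracket_def fil_gen_def fun_eq_iff)
    then have "F y = (\<lambda>_. 0)" if "y \<in> graph_ideal k V E" for y
      using N.fil_hom_ideal_generated[OF F R] that unfolding graph_ideal_def by blast
    then obtain G where G: "fil_hom k (graph_lie_algebra k V E) G"
      "\<And>y. y \<in> carrier ?N \<Longrightarrow> G (graph_ideal k V E +>\<^bsub>?N\<^esub> y) = F y"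
      using fil_hom_quotient[OF F] unfolding graph_lie_algebra_def by metis
    then show "\<exists>F. fil_hom k (graph_lie_algebra k V E) F \<and>
        (\<forall>v\<in>V. F (graph_ideal k V E +>\<^bsub>?N\<^esub> ?x v) = fil_gen \<alpha> \<beta> v)"
      using x Fx by auto
  qed
qed

text \<open>Generators and relations are pushed forward along the isomorphism, filiform
  homomorphisms are composed with its inverse. This moves the presentation to a bracket on
  \<open>\<complex>\<^sup>n\<close>.\<close>

lemma graph_presented_isomorphic:
  assumes pres: "graph_presented k V E A g" and A: "complex_algebra A"
    and iso: "lie_isomorphic A B" and B: "complex_algebra B"
  obtains h where "graph_presented k V E B h"
proof -
  interpret A: complex_algebra A by (rule A)
  interpret B: complex_algebra B by (rule B)
  obtain f where f: "f \<in> LinearCombinations.module_hom class_ring A B"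
    and bij: "bij_betw f (carrier A) (carrier B)"
    and mult: "\<And>x y. \<lbrakk>x \<in> carrier A; y \<in> carrier A\<rbrakk> \<Longrightarrow> f (x \<otimes>\<^bsub>A\<^esub> y) = f x \<otimes>\<^bsub>B\<^esub> f y"
    using iso unfolding lie_isomorphic_def by blast
  have add: "f (x \<oplus>\<^bsub>A\<^esub> y) = f x \<oplus>\<^bsub>B\<^esub> f y" if "x \<in> carrier A" "y \<in> carrier A" for x y
    using LinearCombinations.module_hom_add[OF f] that by blast
  have smult: "f (c \<odot>\<^bsub>A\<^esub> x) = c \<odot>\<^bsub>B\<^esub> f x" if "x \<in> carrier A" for c x
    using LinearCombinations.module_hom_smult[OF f, of c x] that by simp
  have zero: "f \<zero>\<^bsub>A\<^esub> = \<zero>\<^bsub>B\<^esub>"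
  proof -
    have "f \<zero>\<^bsub>A\<^esub> \<in> carrier B" using bij_betwE[OF bij] by simp
    then have "0 \<odot>\<^bsub>B\<^esub> f \<zero>\<^bsub>A\<^esub> = \<zero>\<^bsub>B\<^esub>" by simp
    then show ?thesis using smult[of "\<zero>\<^bsub>A\<^esub>" 0] by (simp only: A.M.zero_closed A.smult_zero)
  qed
  have carrier_B: "carrier B = f ` carrier A" using bij by (simp add: bij_betw_def)
  define f' where "f' = inv_into (carrier A) f"
  have inv: "f' (f x) = x" if "x \<in> carrier A" for x
    using bij that by (simp add: f'_def bij_betw_def)
  have gA: "generates A (g ` V)" using graph_presentedD(1)[OF pres] .
  then have g: "g v \<in> carrier A" if "v \<in> V" for v using that by (auto simp: generates_def)
  have gen: "generates B ((\<lambda>v. f (g v)) ` V)"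
    unfolding generates_def
  proof (intro conjI allI impI; (elim conjE)?)
    show "(\<lambda>v. f (g v)) ` V \<subseteq> carrier B" using g carrier_B by auto
    fix W
    assume W: "W \<subseteq> carrier B" "(\<lambda>v. f (g v)) ` V \<subseteq> W"
      "\<zero>\<^bsub>B\<^esub> \<in> W" "\<forall>c. \<forall>x\<in>W. c \<odot>\<^bsub>B\<^esub> x \<in> W"
      "\<forall>x\<in>W. \<forall>y\<in>W. x \<oplus>\<^bsub>B\<^esub> y \<in> W \<and> x \<otimes>\<^bsub>B\<^esub> y \<in> W"
    have "f x \<in> W" if "x \<in> carrier A" for x
      using gA that A
    proof (induction rule: generates_induct)
      case (gen x)
      then show ?case using W(2) by auto
    qed (simp_all add: W zero add smult mult)
    then show "W = carrier B" 
      using W(1) unfolding carrier_B by (intro subset_antisym image_subsetI)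
  qed
  have hom: "\<exists>F. fil_hom k B F \<and> (\<forall>v \<in> V. F (f (g v)) = fil_gen \<alpha> \<beta> v)"
    if ab: "\<forall>u\<in>V. \<forall>w\<in>V. u \<noteq> w \<longrightarrow> {u, w} \<notin> E \<longrightarrow> \<alpha> u * \<beta> w = \<alpha> w * \<beta> u" for \<alpha> \<beta>
  proof -
    obtain F where F: "fil_hom k A F" and Fg: "\<forall>v \<in> V. F (g v) = fil_gen \<alpha> \<beta> v"
      using graph_presentedD(3)[OF pres, where \<alpha> = \<alpha> and \<beta> = \<beta>] ab by blast
    have "fil_hom k B (\<lambda>y. F (f' y))"
      unfolding fil_hom_def carrier_B ball_simps
    proof (intro conjI ballI allI)
      fix x y assume xy: "x \<in> carrier A" "y \<in> carrier A"
      show "F (f' (f x \<oplus>\<^bsub>B\<^esub> f y)) = (\<lambda>i. F (f' (f x)) i + F (f' (f y)) i)"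
        unfolding add[OF xy, symmetric] using xy by (simp add: inv fil_homD(2)[OF F])
      show "F (f' (f x \<otimes>\<^bsub>B\<^esub> f y)) = fil_bracket k (F (f' (f x))) (F (f' (f y)))"
        unfolding mult[OF xy, symmetric] using xy by (simp add: inv fil_homD(3)[OF F] A.mult_closed)
    next
      fix c x assume x: "x \<in> carrier A"
      show "F (f' (c \<odot>\<^bsub>B\<^esub> f x)) = (\<lambda>i. c * F (f' (f x)) i)"
        unfolding smult[OF x, symmetric] using x by (simp add: inv fil_homD(1)[OF F])
    qed
    moreover have "\<forall>v \<in> V. F (f' (f (g v))) = fil_gen \<alpha> \<beta> v"
      using Fg by (simp add: inv g)
    ultimately show ?thesis by (intro exI[of _ "\<lambda>y. F (f' y)"] conjI)
  qed
  have rel: "f (g u) \<otimes>\<^bsub>B\<^esub> f (g w) = \<zero>\<^bsub>B\<^esub>"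
    if "u \<in> V" "w \<in> V" "u \<noteq> w" "{u, w} \<notin> E" for u w
    using graph_presentedD(2)[OF pres that] that zero mult[OF g g, of u w] by simp
  have "graph_presented k V E B (\<lambda>v. f (g v))"
    using gen rel hom by (rule graph_presentedI)
  then show ?thesis using that by blast
qed

section \<open>Characters and central deformations\<close>

sublocale complex_lie_algebra \<subseteq> complex_algebra L
  by unfold_locales
    (auto intro: bracket_closed bracket_add_left bracket_add_right bracket_smult_left
      bracket_smult_right)

text \<open>These are the linear functionals on the abelianisation \<open>L/[L,L]\<close>.\<close>

definition lie_character :: "(complex, 'a) module \<Rightarrow> ('a \<Rightarrow> complex) \<Rightarrow> bool" where
  "lie_character L h \<longleftrightarrow>
     (\<forall>x \<in> carrier L. \<forall>y \<in> carrier L. h (x \<oplus>\<^bsub>L\<^esub> y) = h x + h y \<and> h (x \<otimes>\<^bsub>L\<^esub> y) = 0) \<and>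
     (\<forall>c. \<forall>x \<in> carrier L. h (c \<odot>\<^bsub>L\<^esub> x) = c * h x)"

lemma lie_characterD:
  assumes "lie_character L h" "x \<in> carrier L"
  shows "h (c \<odot>\<^bsub>L\<^esub> x) = c * h x"
    and "y \<in> carrier L \<Longrightarrow> h (x \<oplus>\<^bsub>L\<^esub> y) = h x + h y"
    and "y \<in> carrier L \<Longrightarrow> h (x \<otimes>\<^bsub>L\<^esub> y) = 0"
  using assms by (auto simp: lie_character_def)

text \<open>Brackets in the filiform algebra have no components along X and
  \<open>Y\<^sub>1\<close>.\<close>

lemma fil_hom_character:
  assumes "fil_hom k L F"
  shows "lie_character L (\<lambda>x. F x 0)" "lie_character L (\<lambda>x. F x (Suc 0))"
  using assms by (auto simp: lie_character_def fil_homD fil_bracket_def)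

context complex_algebra
begin

lemma lie_character_zero: "lie_character A h \<Longrightarrow> h \<zero> = 0"
  using lie_characterD(1)[of A h \<zero> 0] by simp

text \<open>A character only depends on the class modulo brackets, for which the values of the dual
  characters \<open>e i\<close> are coordinates.\<close>

lemma lie_character_expand:
  assumes gen: "generates A (g ` V)" and V: "finite V"
    and e: "\<And>i. i \<in> V \<Longrightarrow> lie_character A (e i)"
    and eg: "\<And>i j. \<lbrakk>i \<in> V; j \<in> V\<rbrakk> \<Longrightarrow> e i (g j) = (if i = j then 1 else 0)"
    and h: "lie_character A h" and x: "x \<in> carrier A"
  shows "h x = (\<Sum>i\<in>V. e i x * h (g i))"
  using gen x complex_algebra_axioms
proof (induction rule: generates_induct)
  case (gen x)
  then obtain j where j: "j \<in> V" "x = g j" by auto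
  have "(\<Sum>i\<in>V. e i x * h (g i)) = (\<Sum>i\<in>V. if i = j then h (g i) else 0)"
    using j by (intro sum.cong) (auto simp: eg)
  then show ?case using j V by simp
next
  case zero
  show ?case using lie_character_zero h e by simp
next
  case (smult c x)
  then show ?case
    by (simp add: lie_characterD(1)[OF h] lie_characterD(1)[OF e] sum_distrib_left mult.assoc)
next
  case (add x y)
  then show ?case
    by (simp add: lie_characterD(2)[OF h] lie_characterD(2)[OF e] sum.distrib algebra_simps)
next
  case (mult x y)
  then show ?case
    by (simp add: lie_characterD(3)[OF h] lie_characterD(3)[OF e])
qed

section \<open>Linear combinations of generators\<close>

definition lin :: "('v \<Rightarrow> 'a) \<Rightarrow> 'v set \<Rightarrow> ('v \<Rightarrow> complex) \<Rightarrow> 'a" where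
  "lin g V c = (\<Oplus>i\<in>V. c i \<odot> g i)"

lemma lin_empty [simp]: "lin g {} c = \<zero>"
  by (simp add: lin_def)

lemma lin_insert:
  "\<lbrakk>finite V; i \<notin> V; g ` insert i V \<subseteq> carrier A\<rbrakk>
    \<Longrightarrow> lin g (insert i V) c = (c i \<odot> g i) \<oplus> lin g V c"
  unfolding lin_def by (intro M.finsum_insert) auto

lemma lin_closed: "g ` V \<subseteq> carrier A \<Longrightarrow> lin g V c \<in> carrier A"
  unfolding lin_def by (intro M.finsum_closed) auto

lemma linear_lin:
  assumes "finite V" "g ` V \<subseteq> carrier A"
    and add: "\<And>x y. \<lbrakk>x \<in> carrier A; y \<in> carrier A\<rbrakk> \<Longrightarrow> h (x \<oplus> y) = h x + h y"
    and smult: "\<And>c x. x \<in> carrier A \<Longrightarrow> h (c \<odot> x) = c * h x"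
  shows "h (lin g V c) = (\<Sum>i\<in>V. c i * (h (g i) :: complex))"
  using assms(1,2)
proof (induction V)
  case empty
  show ?case using smult[of \<zero> 0] by simp
next
  case (insert i V)
  then show ?case by (simp add: lin_insert lin_closed add smult)
qed

lemma lin_combination:
  assumes "finite V" "g ` V \<subseteq> carrier A"
  shows "lin g V (\<lambda>j. p * c j + q * d j) = (p \<odot> lin g V c) \<oplus> (q \<odot> lin g V d)"
  using assms
proof (induction V)
  case (insert i V)
  then have c: "g i \<in> carrier A" "g ` V \<subseteq> carrier A" by auto
  note l = lin_closed[OF c(2)]
  show ?case using insert c l
    by (simp add: lin_insert smult_distrib smult_smult smult_add M.a_ac)
qed auto

lemma mult_lin_zero:
  assumes "finite V" "g ` V \<subseteq> carrier A" "x \<in> carrier A" "\<And>j. j \<in> V \<Longrightarrow> c j \<odot> (x \<otimes> g j) = \<zero>"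
  shows "x \<otimes> lin g V c = \<zero>"
  using assms
proof (induction V)
  case (insert i V)
  then show ?case
    by (simp add: lin_insert lin_closed mult_add_right mult_smult_right)
qed auto

end

context complex_lie_algebra
begin

lemma anticommute: "\<lbrakk>x \<in> carrier L; y \<in> carrier L\<rbrakk> \<Longrightarrow> y \<otimes> x = (-1) \<odot> (x \<otimes> y)"
  by (rule mult_anticommute[OF bracket_self])

text \<open>The bracket of two combinations is a sum over unordered pairs of indices, with the 2 by
  2 minors of the coefficients as factors. Minor and bracket stay together in the assumption because
  for each pair it may be either of them that vanishes.\<close>

lemma lin_commute:
  assumes "finite V" "g ` V \<subseteq> carrier L"
    and "\<And>i j. \<lbrakk>i \<in> V; j \<in> V\<rbrakk> \<Longrightarrow> (c i * d j - d i * c j) \<odot> (g i \<otimes> g j) = \<zero>"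
  shows "lin g V c \<otimes> lin g V d = \<zero>"
  using assms
proof (induction V)
  case (insert a V)
  let ?C = "lin g V c" and ?D = "lin g V d"
  have ga: "g a \<in> carrier L" and gV: "g ` V \<subseteq> carrier L" using insert.prems by auto
  note l = lin_closed[OF gV]
  have "lin g (insert a V) c \<otimes> lin g (insert a V) d
      = ((c a \<odot> g a) \<oplus> ?C) \<otimes> ((d a \<odot> g a) \<oplus> ?D)"
    using insert by (simp add: lin_insert)
  also have "\<dots> = ((c a \<odot> (g a \<otimes> ?D)) \<oplus> (d a \<odot> (?C \<otimes> g a))) \<oplus> (?C \<otimes> ?D)"
    using ga l
    by (simp add: mult_add_left mult_add_right mult_smult_left mult_smult_right mult_closed
        bracket_self M.a_ac)
  also have "?C \<otimes> ?D = \<zero>" using insert gV by simp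
  also have "?C \<otimes> g a = (-1) \<odot> (g a \<otimes> ?C)" using ga l by (intro anticommute)
  \<comment> \<open>All terms involving the new index are collected into one bracket with
    \<open>g a\<close>; the coefficients of the other argument are the minors that the assumption
    speaks of.\<close>
  also have "(c a \<odot> (g a \<otimes> ?D)) \<oplus> (d a \<odot> ((-1) \<odot> (g a \<otimes> ?C)))
      = g a \<otimes> ((c a \<odot> ?D) \<oplus> ((- d a) \<odot> ?C))"
    using ga l by (simp add: mult_add_right mult_smult_right smult_smult mult_closed)
  also have "(c a \<odot> ?D) \<oplus> ((- d a) \<odot> ?C) = lin g V (\<lambda>j. c a * d j + (- d a) * c j)"
    using insert.hyps(1) gV by (rule lin_combination[symmetric])
  also have "g a \<otimes> \<dots> = \<zero>"
    using insert.hyps gV ga insert.prems(2)[of a] by (intro mult_lin_zero) auto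
  finally show ?case by simp
qed auto

end

section \<open>Deforming a bracket along a central element\<close>

definition deformed_bracket ::
  "(complex, 'a) module \<Rightarrow> ('a \<Rightarrow> complex) \<Rightarrow> ('a \<Rightarrow> complex) \<Rightarrow> 'a \<Rightarrow> complex \<Rightarrow> 'a \<Rightarrow> 'a \<Rightarrow> 'a" where
  "deformed_bracket L a b z t x y = (x \<otimes>\<^bsub>L\<^esub> y) \<oplus>\<^bsub>L\<^esub> ((t * (a x * b y - a y * b x)) \<odot>\<^bsub>L\<^esub> z)"

text \<open>Since \<open>a\<close> and \<open>b\<close> vanish on brackets and on \<open>z\<close>,
  and \<open>z\<close> is central, the added term contributes nothing to double brackets. So the
  Jacobi identity holds for every parameter.\<close>

locale central_deformation = complex_lie_algebra L for L :: "(complex, 'a) module" (structure) +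
  fixes a b :: "'a \<Rightarrow> complex" and z :: 'a
  assumes a: "lie_character L a" and b: "lie_character L b" and z: "z \<in> carrier L"
    and az: "a z = 0" and bz: "b z = 0" and central: "x \<in> carrier L \<Longrightarrow> x \<otimes> z = \<zero>"
begin

abbreviation "D \<equiv> deformed_bracket L a b z"

lemma D_closed: "\<lbrakk>x \<in> carrier L; y \<in> carrier L\<rbrakk> \<Longrightarrow> D t x y \<in> carrier L"
  using z by (simp add: deformed_bracket_def mult_closed)

lemma character_D:
  assumes "lie_character L h" "h z = 0" "x \<in> carrier L" "y \<in> carrier L"
  shows "h (D t x y) = 0"
  using assms z by (simp add: deformed_bracket_def lie_characterD mult_closed)

lemma mult_D: "\<lbrakk>x \<in> carrier L; y \<in> carrier L; v \<in> carrier L\<rbrakk> \<Longrightarrow> v \<otimes> D t x y = v \<otimes> (x \<otimes> y)"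
  using z by (simp add: deformed_bracket_def mult_closed mult_add_right mult_smult_right central)

lemma D_eq: "\<lbrakk>x \<in> carrier L; y \<in> carrier L; a y = 0; b y = 0\<rbrakk> \<Longrightarrow> D t x y = x \<otimes> y"
  using z by (simp add: deformed_bracket_def mult_closed)

text \<open>The inner correction is a multiple of the central element \<open>z\<close>, and the
  outer one is formed from the values of \<open>a\<close> and \<open>b\<close> at a deformed
  bracket, which are zero.\<close>

lemma D_D: "\<lbrakk>x \<in> carrier L; y \<in> carrier L; v \<in> carrier L\<rbrakk> \<Longrightarrow> D t v (D t x y) = v \<otimes> (x \<otimes> y)"
  using D_eq[of v "D t x y" t] D_closed[of x y t] character_D[OF a az] character_D[OF b bz] mult_D
  by simp

context
  fixes m t
  assumes m: "\<And>x y. \<lbrakk>x \<in> carrier L; y \<in> carrier L\<rbrakk> \<Longrightarrow> m x y = D t x y"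
begin

text \<open>Jacobi comes from \<open>D_D\<close>. The product \<open>m\<close> agrees with
  \<open>D t\<close> on the carrier only, as brackets in \<open>nilpotent_brackets\<close> are
  \<open>undefined\<close> elsewhere.\<close>

lemma complex_lie_algebra_deformed: "complex_lie_algebra (L\<lparr>mult := m\<rparr>)"
proof -
  let ?L = "L\<lparr>mult := m\<rparr>"
  have "abelian_group ?L"
    by (rule abelian_groupI) (auto simp: M.a_ac intro: bexI[of _ "\<ominus> x" for x] M.l_neg)
  then have "vectorspace (class_ring :: complex ring) ?L"
    by (rule complex_vectorspaceI) (auto simp: smult_add smult_distrib smult_smult)
  moreover have "complex_lie_algebra_axioms ?L"
  proof (unfold_locales, goal_cases)
    case (1 x y) then show ?case by (simp add: m D_closed)
  next
    case (2 x y v) then show ?case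
      using z by (simp add: m deformed_bracket_def mult_add_left mult_closed lie_characterD[OF a]
          lie_characterD[OF b] smult_add[symmetric] M.a_ac) (simp add: algebra_simps)
  next
    case (3 x y v) then show ?case
      using z by (simp add: m deformed_bracket_def mult_add_right mult_closed lie_characterD[OF a]
          lie_characterD[OF b] smult_add[symmetric] M.a_ac) (simp add: algebra_simps)
  next
    case (4 x y c) then show ?case
      using z by (simp add: m deformed_bracket_def mult_smult_left mult_closed lie_characterD[OF a]
          lie_characterD[OF b] smult_distrib smult_smult algebra_simps)
  next
    case (5 x y c) then show ?case
      using z by (simp add: m deformed_bracket_def mult_smult_right mult_closed lie_characterD[OF a]
          lie_characterD[OF b] smult_distrib smult_smult algebra_simps)
  next
    case (6 x) then show ?case
      using z by (simp add: m deformed_bracket_def bracket_self)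
  next
    case (7 x y v) then show ?case
      using jacobi by (simp add: m D_closed D_D)
  qed
  ultimately show ?thesis by (simp add: complex_lie_algebra_def)
qed

text \<open>The inclusion starts at index 2 because a single deformed bracket may involve
  \<open>z\<close>, which can lie outside \<open>[L,L]\<close>, for instance when \<open>L\<close>
  is abelian. One more bracket removes it.\<close>

lemma lower_central_deformed:
  "lower_central (L\<lparr>mult := m\<rparr>) (Suc (Suc i)) \<subseteq> lower_central L (Suc (Suc i))"
proof -
  let ?L = "L\<lparr>mult := m\<rparr>"
  interpret D: complex_lie_algebra ?L by (rule complex_lie_algebra_deformed)
  \<comment> \<open>A deformed bracket agrees with the original one only up to a multiple of
    \<open>z\<close>, so the induction records how it multiplies, and that \<open>a\<close> and
    \<open>b\<close> vanish on it.\<close>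
  let ?W = "\<lambda>i. {y \<in> carrier L. a y = 0 \<and> b y = 0 \<and>
    (\<forall>x \<in> carrier L. x \<otimes> y \<in> lower_central L (Suc (Suc i)))}"
  note LC = subspaceD[OF lower_central_subspace]
  have sub: "VectorSpace.subspace class_ring (?W i) ?L" for i
    by (rule D.subspaceI)
      (auto simp: lie_characterD[OF a] lie_characterD[OF b] lie_character_zero[OF a]
        lie_character_zero[OF b] mult_add_right mult_smult_right LC simp del: lower_central.simps)
  have D_LC: "D t x y \<in> lower_central L (Suc (Suc i))" if "x \<in> carrier L" "y \<in> ?W i" for i x y
  proof -
    have "D t x y = x \<otimes> y" using that by (intro D_eq) auto
    then show ?thesis using that by (simp del: lower_central.simps)
  qed
  have W: "lower_central ?L (Suc i) \<subseteq> ?W i" for i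
  proof (induction i)
    case 0
    show ?case
    proof (rule D.lower_central_subset[OF sub])
      fix x y assume "x \<in> carrier ?L" "y \<in> lower_central ?L 0"
      then have xy: "x \<in> carrier L" "y \<in> carrier L" by auto
      then have "v \<otimes> D t x y \<in> lower_central L (Suc (Suc 0))" if "v \<in> carrier L" for v
        using that by (auto simp only: mult_D lower_central.simps(1) intro!: mult_mem_lower_central)
      then show "x \<otimes>\<^bsub>?L\<^esub> y \<in> ?W 0"
        using xy by (auto simp: m D_closed character_D[OF a az] character_D[OF b bz]
            simp del: lower_central.simps)
    qed
  next
    case (Suc i)
    show ?case
    proof (rule D.lower_central_subset[OF sub])
      fix x y assume x: "x \<in> carrier ?L" and y: "y \<in> lower_central ?L (Suc i)"
      then have xy: "x \<in> carrier L" "y \<in> ?W i" using Suc by auto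
      then have "v \<otimes> D t x y \<in> lower_central L (Suc (Suc (Suc i)))" if "v \<in> carrier L" for v
        using that mult_mem_lower_central[of v "x \<otimes> y"]
        by (auto simp: mult_D simp del: lower_central.simps)
      then show "x \<otimes>\<^bsub>?L\<^esub> y \<in> ?W (Suc i)"
        using xy by (auto simp: m D_closed character_D[OF a az] character_D[OF b bz]
            simp del: lower_central.simps)
    qed
  qed
  show ?thesis
  proof (rule D.lower_central_subset)
    show "VectorSpace.subspace class_ring (lower_central L (Suc (Suc i))) ?L"
      by (rule D.subspaceI)
        (use subspaceD[OF lower_central_subspace[of "Suc (Suc i)"]] in
          \<open>auto simp del: lower_central.simps\<close>)
    fix x y assume "x \<in> carrier ?L" "y \<in> lower_central ?L (Suc i)"
    then show "x \<otimes>\<^bsub>?L\<^esub> y \<in> lower_central L (Suc (Suc i))"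
      using D_LC[of x y i] W[of i] by (auto simp: m simp del: lower_central.simps)
  qed
qed

lemma nilpotent_deformed:
  assumes "at_most_step_nilpotent k L" "k \<ge> 2"
  shows "at_most_step_nilpotent k (L\<lparr>mult := m\<rparr>)"
proof -
  interpret D: complex_lie_algebra "L\<lparr>mult := m\<rparr>" by (rule complex_lie_algebra_deformed)
  have "Suc (Suc (k - 2)) = k" using assms by simp
  then have "lower_central (L\<lparr>mult := m\<rparr>) k \<subseteq> {\<zero>}"
    using lower_central_deformed[of "k - 2"] assms
    by (simp add: at_most_step_nilpotent_def del: lower_central.simps)
  then show ?thesis
    using D.subspaceD(2)[OF D.lower_central_subspace, of k] by (auto simp: at_most_step_nilpotent_def)
qed

end

end

section \<open>Isomorphisms between the original and the deformed bracket\<close>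

context central_deformation
begin

text \<open>Here \<open>\<phi>\<close> leads from the original bracket to \<open>D t\<close>, and
  \<open>\<psi>\<close> leads back.\<close>

definition deformation_isomorphism :: "complex \<Rightarrow> ('a \<Rightarrow> 'a) \<Rightarrow> ('a \<Rightarrow> 'a) \<Rightarrow> bool" where
  "deformation_isomorphism t \<phi> \<psi> \<longleftrightarrow>
     \<phi> \<in> carrier L \<rightarrow> carrier L \<and> \<psi> \<in> carrier L \<rightarrow> carrier L \<and>
     (\<forall>x \<in> carrier L. \<forall>y \<in> carrier L. \<phi> (x \<oplus> y) = \<phi> x \<oplus> \<phi> y \<and>
        \<phi> (x \<otimes> y) = D t (\<phi> x) (\<phi> y) \<and> \<psi> (D t x y) = \<psi> x \<otimes> \<psi> y) \<and>
     (\<forall>c. \<forall>x \<in> carrier L. \<phi> (c \<odot> x) = c \<odot> \<phi> x \<and> \<psi> (c \<odot> x) = c \<odot> \<psi> x) \<and>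
     (\<forall>x \<in> carrier L. \<phi> (\<psi> x) = x)"

definition nontrivial where
  "nontrivial \<longleftrightarrow> (\<forall>t \<phi> \<psi>. deformation_isomorphism t \<phi> \<psi> \<longrightarrow> t = 0)"

lemma deformation_isomorphismD:
  assumes "deformation_isomorphism t \<phi> \<psi>" "x \<in> carrier L"
  shows "\<phi> x \<in> carrier L" "\<psi> x \<in> carrier L" "\<phi> (c \<odot> x) = c \<odot> \<phi> x" "\<psi> (c \<odot> x) = c \<odot> \<psi> x"
    and "\<phi> (\<psi> x) = x"
    and "y \<in> carrier L \<Longrightarrow> \<phi> (x \<oplus> y) = \<phi> x \<oplus> \<phi> y"
    and "y \<in> carrier L \<Longrightarrow> \<phi> (x \<otimes> y) = D t (\<phi> x) (\<phi> y)"
    and "y \<in> carrier L \<Longrightarrow> \<psi> (D t x y) = \<psi> x \<otimes> \<psi> y"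
  using assms by (auto simp: deformation_isomorphism_def)

lemma deformation_isomorphism_zero:
  assumes "deformation_isomorphism t \<phi> \<psi>"
  shows "\<phi> \<zero> = \<zero>"
  using deformation_isomorphismD(3)[OF assms M.zero_closed, of 0]
    deformation_isomorphismD(1)[OF assms M.zero_closed] by simp

end

section \<open>Nontrivial deformations of graph Lie algebras\<close>

abbreviation kron :: "'v \<Rightarrow> 'v \<Rightarrow> complex" where
  "kron i \<equiv> \<lambda>j. if j = i then 1 else 0"

text \<open>With \<beta> = 0 the commutation condition is empty, so \<alpha> can be prescribed
  freely; the X-coordinate of the resulting homomorphism is the character.\<close>

lemma dual_characters:
  assumes "graph_presented k V E L g"
  obtains e where "\<And>i. i \<in> V \<Longrightarrow> lie_character L (e i)"
    "\<And>i j. \<lbrakk>i \<in> V; j \<in> V\<rbrakk> \<Longrightarrow> e i (g j) = (if i = j then 1 else 0 :: complex)"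
proof -
  have "\<exists>h. lie_character L h \<and> (\<forall>j \<in> V. h (g j) = kron i j)" for i
  proof -
    obtain F where F: "fil_hom k L F" "\<forall>v \<in> V. F (g v) = fil_gen (kron i) (\<lambda>_. 0) v"
      using graph_presentedD(3)[OF assms, of "kron i" "\<lambda>_. 0"] by auto
    then show ?thesis
      by (intro exI[of _ "\<lambda>x. F x 0"]) (auto simp: fil_hom_character(1) fil_gen_def)
  qed
  then obtain e where "\<And>i. lie_character L (e i)" "\<And>i j. j \<in> V \<Longrightarrow> e i (g j) = kron i j"
    by metis
  then show ?thesis by (intro that[of e]) auto
qed

text \<open>Send \<open>i\<close> to X, \<open>j\<close> to \<open>Y\<^sub>1\<close> and the other
  vertices to 0. Only the adjacent pair \<open>i\<close>, \<open>j\<close> can have a nonzero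
  bracket, so the relations of the graph are respected.\<close>

lemma edge_fil_hom:
  assumes pres: "graph_presented k V E L g" and ij: "{i, j} \<in> E"
  obtains F where "fil_hom k L F" "\<And>v. v \<in> V \<Longrightarrow> F (g v) = fil_gen (kron i) (kron j) v"
proof -
  have "kron i u * kron j w = kron i w * kron j u"
    if "u \<noteq> w" "{u, w} \<notin> E" for u w
    using that ij by (auto simp: insert_commute)
  then show ?thesis
    using graph_presentedD(3)[OF pres, of "kron i" "kron j"] that by blast
qed

lemma deformation_edge:
  fixes L (structure)
  assumes "complex_lie_algebra L" and pres: "graph_presented k V E L g" and V: "finite V"
    and E: "E \<subseteq> all_edges V"
    and nil: "at_most_step_nilpotent k L" and k: "k \<ge> 3"
    and uw: "u \<in> V" "w \<in> V" "u \<noteq> w" "{u, w} \<notin> E" and c: "c \<in> V" "{c, u} \<in> E"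
  obtains a b z where "central_deformation L a b z" "central_deformation.nontrivial L a b z"
proof -
  interpret complex_lie_algebra L by fact
  obtain e where e: "\<And>i. i \<in> V \<Longrightarrow> lie_character L (e i)"
    and eg: "\<And>i j. \<lbrakk>i \<in> V; j \<in> V\<rbrakk> \<Longrightarrow> e i (g j) = (if i = j then 1 else 0)"
    using dual_characters[OF pres] by blast
  have gen: "generates L (g ` V)" by (rule graph_presentedD[OF pres])
  then have gV: "g ` V \<subseteq> carrier L" by (simp add: generates_def)
  then have g: "g i \<in> carrier L" if "i \<in> V" for i using that by blast
  have edge: "i \<noteq> j" "i \<in> V" "j \<in> V" if "{i, j} \<in> E" for i j
    using E that unfolding all_edges_def by (auto simp: doubleton_eq_iff)
  \<comment> \<open>\<open>c\<close> differs from \<open>w\<close> because it is adjacent to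
    \<open>u\<close> and \<open>w\<close> is not.\<close>
  have cu: "c \<noteq> u" "c \<noteq> w" using edge(1)[OF c(2)] uw c by (auto simp: insert_commute)
  have expand: "h x = (\<Sum>i\<in>V. e i x * h (g i))" if "lie_character L h" "x \<in> carrier L" for h x
    using lie_character_expand[OF gen V e eg that] by simp
  have unique: "h x = h' x" if "lie_character L h" "lie_character L h'"
    "\<And>i. i \<in> V \<Longrightarrow> h (g i) = h' (g i)" "x \<in> carrier L" for h h' x
    unfolding expand[OF that(1,4)] expand[OF that(2,4)] using that(3) by simp
  define ad where "ad j = ((\<lambda>y. g c \<otimes> y) ^^ j) (g u)" for j
  have ad_Suc: "ad (Suc j) = g c \<otimes> ad j" for j by (simp add: ad_def)
  have ad_LC: "ad j \<in> lower_central L j" for j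
  proof (induction j)
    case (Suc j)
    then show ?case unfolding ad_Suc using g[OF c(1)] by (rule mult_mem_lower_central[rotated])
  qed (simp add: ad_def g uw)
  then have ad: "ad j \<in> carrier L" for j using lower_central_closed by blast
  define z where "z = ad (k - 1)"
  \<comment> \<open>As k \<ge> 3, the k - 1 applications of ad c include two outermost ones, so that
    \<open>z\<close> is [c, [c, \<open>ad l\<close>]].\<close>
  obtain l where l: "k = Suc (Suc (Suc l))" using k by (metis Suc_le_D numeral_3_eq_3 Suc_le_mono)
  have z_ad: "z = g c \<otimes> ad (Suc l)" by (simp add: z_def l ad_Suc)
  have char_z: "h z = 0" if "lie_character L h" for h
    unfolding z_ad using that g[OF c(1)] ad by (rule lie_characterD)
  interpret central_deformation L "e u" "e w" z
  proof unfold_locales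
    show "x \<otimes> z = \<zero>" if "x \<in> carrier L" for x
    proof -
      have "x \<otimes> z \<in> lower_central L k"
        using mult_mem_lower_central[OF that ad_LC[of "k - 1"]] k by (simp add: z_def l del: lower_central.simps)
      then show ?thesis using nil by (simp add: at_most_step_nilpotent_def)
    qed
  qed (use e uw ad char_z in \<open>auto simp: z_def\<close>)
  have "t = 0" if iso: "deformation_isomorphism t \<phi> \<psi>" for t \<phi> \<psi>
  proof -
    note I = deformation_isomorphismD[OF iso]
    define B where "B i = e i (\<psi> (g u))" for i
    define C where "C i = e i (\<psi> (g w))" for i
    let ?P = "\<phi> (lin g V B)" and ?Q = "\<phi> (lin g V C)"
    have \<psi>g: "\<psi> (g i) \<in> carrier L" if "i \<in> V" for i using that g I(2) by blast
    have \<psi>_ad: "\<psi> (g c \<otimes> ad j) = \<psi> (g c) \<otimes> \<psi> (ad j)" for j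
    proof -
      \<comment> \<open>Both \<open>e u\<close> and \<open>e w\<close> vanish at \<open>g c\<close>,
        so brackets with \<open>g c\<close> are undeformed.\<close>
      have "D t (g c) (ad j) = g c \<otimes> ad j"
        using g[OF c(1)] ad z cu uw c by (simp add: deformed_bracket_def eg mult_closed)
      then show ?thesis using I(8)[OF g[OF c(1)] ad[of j]] by simp
    qed
    have "D t (g u) (g w) = t \<odot> z"
      using graph_presentedD(2)[OF pres uw] z uw by (simp add: deformed_bracket_def eg)
    then have \<psi>_uw: "\<psi> (g u) \<otimes> \<psi> (g w) = t \<odot> \<psi> z"
      using I(8)[OF g[OF uw(1)] g[OF uw(2)]] I(4)[OF z] by simp
    \<comment> \<open>The coordinate \<open>Y\<^sub>2\<close> vanishes on triple brackets, so it kills \<open>[\<psi> u, \<psi> w] = t \<psi> z\<close>.\<close>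
    have BC: "B i * C j = C i * B j" if ij: "{i, j} \<in> E" for i j
    proof -
      obtain F where F: "fil_hom k L F" and Fg: "\<And>v. v \<in> V \<Longrightarrow> F (g v) = fil_gen (kron i) (kron j) v"
        using edge_fil_hom[OF pres ij] by blast
      note H = fil_homD[OF F]
      have F0: "F x 0 = e i x" if "x \<in> carrier L" for x
        by (rule unique[OF fil_hom_character(1)[OF F] e])
          (use that edge[OF ij] in \<open>auto simp: Fg eg fil_gen_def\<close>)
      have F1: "F x (Suc 0) = e j x" if "x \<in> carrier L" for x
        by (rule unique[OF fil_hom_character(2)[OF F] e])
          (use that edge[OF ij] in \<open>auto simp: Fg eg fil_gen_def\<close>)
      have "F (\<psi> (g u) \<otimes> \<psi> (g w)) 2 = B i * C j - C i * B j"
        using \<psi>g uw k by (simp add: H fil_bracket_def F0 F1 B_def C_def)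
      moreover have "\<psi> z = \<psi> (g c) \<otimes> (\<psi> (g c) \<otimes> \<psi> (ad l))"
        unfolding z_ad \<psi>_ad unfolding ad_Suc \<psi>_ad ..
      then have "F (\<psi> z) 2 = 0"
        using \<psi>g[OF c(1)] I(2)[OF ad] by (simp add: H mult_closed fil_bracket_def)
      ultimately show ?thesis
        using H(1)[OF I(2)[OF z]] by (simp add: \<psi>_uw)
    qed
    have "lin g V B \<otimes> lin g V C = \<zero>"
    proof (rule lin_commute[OF V gV])
      fix i j assume ij: "i \<in> V" "j \<in> V"
      \<comment> \<open>On edges the minor vanishes by \<open>BC\<close>; on non-edges the bracket
        vanishes by the relations.\<close>
      consider "i = j" | "{i, j} \<in> E" | "i \<noteq> j" "{i, j} \<notin> E" by blast
      then show "(B i * C j - C i * B j) \<odot> (g i \<otimes> g j) = \<zero>"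
      proof cases
        case 1
        then show ?thesis using g ij bracket_self by simp
      next
        case 2
        then show ?thesis using BC g ij by (simp add: mult_closed)
      next
        case 3
        then show ?thesis using graph_presentedD(2)[OF pres] ij by simp
      qed
    qed
    then have PQ: "D t ?P ?Q = \<zero>"
      using I(7)[OF lin_closed[OF gV] lin_closed[OF gV], of B C] deformation_isomorphism_zero[OF iso]
      by simp
    have PQ_closed: "?P \<in> carrier L" "?Q \<in> carrier L"
      using I(1) lin_closed[OF gV] by auto
    \<comment> \<open>Up to brackets, \<open>\<phi>\<close> maps the linear part of \<open>\<psi> x\<close> to \<open>x\<close>.\<close>
    have transport: "h (\<phi> (lin g V (\<lambda>i. e i (\<psi> x)))) = h x"
      if h: "lie_character L h" and x: "x \<in> carrier L" for h x
    proof -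
      note hD = lie_characterD[OF h]
      \<comment> \<open>\<open>h\<close> also vanishes on deformed brackets, because
        \<open>h z = 0\<close>. Hence its composition with \<open>\<phi>\<close> is a character of
        the original bracket and can be expanded at \<open>\<psi> x\<close>.\<close>
      have "lie_character L (\<lambda>x. h (\<phi> x))"
        unfolding lie_character_def
        by (auto simp: I hD character_D[OF h char_z[OF h]])
      then have "h (\<phi> (\<psi> x)) = (\<Sum>i\<in>V. e i (\<psi> x) * h (\<phi> (g i)))"
        using expand I(2)[OF x] by blast
      also have "\<dots> = h (\<phi> (lin g V (\<lambda>i. e i (\<psi> x))))"
        by (rule linear_lin[OF V gV, symmetric]) (auto simp: I hD)
      finally show ?thesis using I(5)[OF x] by simp
    qed
    have hP: "h ?P = h (g u)" and hQ: "h ?Q = h (g w)" if "lie_character L h" for h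
      using transport[OF that] g uw unfolding B_def C_def by auto
    obtain F where F: "fil_hom k L F" and Fg: "\<And>v. v \<in> V \<Longrightarrow> F (g v) = fil_gen (kron c) (kron u) v"
      using edge_fil_hom[OF pres c(2)] by blast
    note H = fil_homD[OF F]
    \<comment> \<open>\<open>F\<close> sends c to X and u to \<open>Y\<^sub>1\<close>, so each ad c
      raises the index by one and \<open>z\<close> goes to \<open>Y\<^sub>k\<close>.\<close>
    have F_ad: "F (ad j) = (\<lambda>i. if i = Suc j then 1 else 0)" if "Suc j \<le> k" for j
      using that
    proof (induction j)
      case 0
      show ?case using uw cu by (auto simp: ad_def Fg fil_gen_def)
    next
      case (Suc j)
      then show ?case
        using g[OF c(1)] ad[of j] c(1) cu by (auto simp: ad_Suc H Fg fil_bracket_def fil_gen_def fun_eq_iff)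
    qed
    \<comment> \<open>The X-coordinate is a character, so it has the same value at \<open>?P\<close>
      and \<open>?Q\<close> as at \<open>g u\<close> and \<open>g w\<close>, where it is zero.
      Elements of the filiform algebra without X-component commute.\<close>
    have "F ?P 0 = 0" "F ?Q 0 = 0"
      using hP[OF fil_hom_character(1)[OF F]] hQ[OF fil_hom_character(1)[OF F]] uw cu
      by (simp_all add: Fg fil_gen_def)
    then have "F (?P \<otimes> ?Q) k = 0"
      using PQ_closed by (simp add: H fil_bracket_def)
    moreover have "F z k = 1" using F_ad[of "k - 1"] k by (simp add: z_def)
    \<comment> \<open>The same transport applied to \<open>e u\<close> and \<open>e w\<close> gives
      the form a \<and> b the value 1 on \<open>?P\<close> and \<open>?Q\<close>, as on
      \<open>g u\<close> and \<open>g w\<close>.\<close>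
    moreover have "D t ?P ?Q = (?P \<otimes> ?Q) \<oplus> (t \<odot> z)"
      using hP[OF e] hQ[OF e] uw by (simp add: deformed_bracket_def eg)
    ultimately have "F (D t ?P ?Q) k = t"
      using PQ_closed z by (simp add: H mult_closed)
    then show ?thesis by (simp add: PQ fil_hom_zero[OF F])
  qed
  then have "nontrivial" by (auto simp: nontrivial_def)
  then show ?thesis using that central_deformation_axioms by blast
qed

lemma deformation_abelian:
  fixes L (structure)
  assumes "complex_lie_algebra L" and pres: "graph_presented k V {} L g" and V: "card V \<ge> 3"
  obtains a b z where "central_deformation L a b z" "central_deformation.nontrivial L a b z"
proof -
  interpret complex_lie_algebra L by fact
  obtain e where e: "\<And>i. i \<in> V \<Longrightarrow> lie_character L (e i)"
    and eg: "\<And>i j. \<lbrakk>i \<in> V; j \<in> V\<rbrakk> \<Longrightarrow> e i (g j) = (if i = j then 1 else 0)"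
    using dual_characters[OF pres] by blast
  have gen: "generates L (g ` V)" by (rule graph_presentedD[OF pres])
  then have g: "g i \<in> carrier L" if "i \<in> V" for i using that by (auto simp: generates_def)
  have comm: "g i \<otimes> g j = \<zero>" if "i \<in> V" "j \<in> V" for i j
    using graph_presentedD(2)[OF pres that] bracket_self g that by (cases "i = j") auto
  \<comment> \<open>By the Jacobi identity the centraliser of \<open>g i\<close> is a subalgebra,
    and it contains all generators.\<close>
  have gx: "g i \<otimes> x = \<zero>" if i: "i \<in> V" and x: "x \<in> carrier L" for i x
    using gen x complex_algebra_axioms
  proof (induction rule: generates_induct)
    case (mult x y)
    have "y \<otimes> g i = \<zero>" using anticommute[OF g[OF i] mult(2)] mult(4) by simp
    then show ?case using jacobi[OF g[OF i] mult(1,2)] mult g[OF i] by (simp add: mult_closed)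
  qed (use comm i g in \<open>auto simp: mult_add_right mult_smult_right\<close>)
  have "\<forall>y \<in> carrier L. x \<otimes> y = \<zero>" if x: "x \<in> carrier L" for x
    using gen x complex_algebra_axioms
    by (induction rule: generates_induct) (use gx in \<open>auto simp: mult_add_left mult_smult_left\<close>)
  then have abelian: "x \<otimes> y = \<zero>" if "x \<in> carrier L" "y \<in> carrier L" for x y
    using that by blast
  obtain T where "T \<subseteq> V" "card T = 3" using V by (meson obtain_subset_with_card_n)
  then obtain u w s where V: "u \<in> V" "w \<in> V" "s \<in> V" and ne: "u \<noteq> w" "u \<noteq> s" "w \<noteq> s"
    by (auto simp: card_3_iff)
  \<comment> \<open>A third vertex \<open>s\<close> supplies the central element; being different
    from \<open>u\<close> and \<open>w\<close>, it is killed by both characters.\<close>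
  interpret central_deformation L "e u" "e w" "g s"
    by unfold_locales (use e V ne abelian g in \<open>auto simp: eg\<close>)
  have "t = 0" if iso: "deformation_isomorphism t \<phi> \<psi>" for t \<phi> \<psi>
  proof -
    note I = deformation_isomorphismD[OF iso]
    have \<psi>: "\<psi> (g u) \<in> carrier L" "\<psi> (g w) \<in> carrier L" using I(2) g V by auto
    have "D t (g u) (g w) = \<phi> (\<psi> (g u) \<otimes> \<psi> (g w))"
      using I(7)[OF \<psi>] I(5) g V by simp
    also have "\<dots> = \<zero>" using abelian \<psi> deformation_isomorphism_zero[OF iso] by simp
    finally have "t \<odot> g s = \<zero>"
      using V ne g by (simp add: deformed_bracket_def eg comm)
    \<comment> \<open>The dual character \<open>e s\<close> takes the value 1 at \<open>g s\<close>
      and so reads off the coefficient \<open>t\<close>.\<close>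
    then have "e s (t \<odot> g s) = 0" using lie_character_zero e V by simp
    then show ?thesis using lie_characterD(1)[OF e[OF V(3)] g[OF V(3)]] V by (simp add: eg)
  qed
  then have "nontrivial" by (auto simp: nontrivial_def)
  then show ?thesis using that central_deformation_axioms by blast
qed

section \<open>Non-rigidity\<close>

lemma bracket_algebra_simps [simp]:
  "carrier (bracket_algebra n \<mu>) = carrier_vec n" "mult (bracket_algebra n \<mu>) = \<mu>"
  "add (bracket_algebra n \<mu>) = (+)" "smult (bracket_algebra n \<mu>) = (\<cdot>\<^sub>v)"
  "zero (bracket_algebra n \<mu>) = 0\<^sub>v n" "(bracket_algebra n \<mu>)\<lparr>mult := \<nu>\<rparr> = bracket_algebra n \<nu>"
  by (simp_all add: bracket_algebra_def module_vec_def)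

lemma GL_complex_inverse:
  assumes "h \<in> GL_complex n"
  shows "h \<in> carrier_mat n n" "inv\<^bsub>complex_mat_ring n\<^esub> h \<in> carrier_mat n n"
    and "h * inv\<^bsub>complex_mat_ring n\<^esub> h = 1\<^sub>m n" "inv\<^bsub>complex_mat_ring n\<^esub> h * h = 1\<^sub>m n"
proof -
  interpret R: ring "complex_mat_ring n" by (rule ring_mat)
  have h: "h \<in> Units (complex_mat_ring n)" using assms by (simp add: GL_complex_def)
  show "h \<in> carrier_mat n n" using R.Units_closed[OF h] by (simp add: ring_mat_simps)
  show "inv\<^bsub>complex_mat_ring n\<^esub> h \<in> carrier_mat n n"
    using R.Units_inv_closed[OF h] by (simp add: ring_mat_simps)
  show "h * inv\<^bsub>complex_mat_ring n\<^esub> h = 1\<^sub>m n" "inv\<^bsub>complex_mat_ring n\<^esub> h * h = 1\<^sub>m n"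
    using R.Units_r_inv[OF h] R.Units_l_inv[OF h] by (simp_all add: ring_mat_simps)
qed

text \<open>The identity matrix acts trivially. The case distinctions deal with arguments outside
  \<open>carrier_vec n\<close>, where both sides are \<open>undefined\<close>.\<close>

lemma mem_bracket_orbit_self:
  assumes \<mu>: "\<mu> \<in> carrier_vec n \<rightarrow>\<^sub>E (carrier_vec n \<rightarrow>\<^sub>E carrier_vec n)"
  shows "\<mu> \<in> bracket_orbit n \<mu>"
proof -
  interpret R: ring "complex_mat_ring n" by (rule ring_mat)
  have 1: "1\<^sub>m n \<in> GL_complex n"
    using R.Units_one_closed by (simp add: GL_complex_def ring_mat_simps)
  have inv: "inv\<^bsub>complex_mat_ring n\<^esub> 1\<^sub>m n = 1\<^sub>m n"
    using R.inv_one by (simp add: ring_mat_simps)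
  have "GL_action n (1\<^sub>m n) \<mu> x y = \<mu> x y" for x y
  proof (cases "x \<in> carrier_vec n")
    case x: True
    then have \<mu>x: "\<mu> x \<in> carrier_vec n \<rightarrow>\<^sub>E carrier_vec n" using \<mu> by auto
    show ?thesis
    proof (cases "y \<in> carrier_vec n")
      case True
      then have "\<mu> x y \<in> carrier_vec n" using \<mu>x by auto
      then show ?thesis using x True by (simp add: GL_action_def inv)
    next
      case False
      then show ?thesis using \<mu>x x by (auto simp: GL_action_def)
    qed
  next
    case False
    then show ?thesis using \<mu> by (auto simp: GL_action_def)
  qed
  then have "\<mu> = GL_action n (1\<^sub>m n) \<mu>" by (intro ext) simp
  then show ?thesis using 1 unfolding bracket_orbit_def by blast
qed

lemma not_k_rigid_bracket:
  assumes \<mu>: "\<mu> \<in> nilpotent_brackets n k" and k: "k \<ge> 2"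
    and "central_deformation (bracket_algebra n \<mu>) a b z"
    and nontriv: "central_deformation.nontrivial (bracket_algebra n \<mu>) a b z"
  shows "\<not> k_rigid_bracket n k \<mu>"
proof
  assume "k_rigid_bracket n k \<mu>"
  then obtain P where P: "P \<subseteq> bracket_polynomials n"
    and orbit: "bracket_orbit n \<mu> = nilpotent_brackets n k - {\<nu>. \<forall>p\<in>P. p \<nu> = 0}"
    unfolding k_rigid_bracket_def zariski_open_in_def by blast
  interpret central_deformation "bracket_algebra n \<mu>" a b z by fact
  have \<mu>E: "\<mu> \<in> carrier_vec n \<rightarrow>\<^sub>E (carrier_vec n \<rightarrow>\<^sub>E carrier_vec n)"
    and nil: "at_most_step_nilpotent k (bracket_algebra n \<mu>)"
    using \<mu> by (auto simp: nilpotent_brackets_def)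
  have z': "z \<in> carrier_vec n" using z by simp
  have \<mu>_closed: "\<mu> x y \<in> carrier_vec n" if "x \<in> carrier_vec n" "y \<in> carrier_vec n" for x y
    using mult_closed[of x y] that by simp
  define \<nu> where "\<nu> t = (\<lambda>x\<in>carrier_vec n. \<lambda>y\<in>carrier_vec n. D t x y)" for t
  have \<nu>: "\<nu> t x y = D t x y" if "x \<in> carrier_vec n" "y \<in> carrier_vec n" for t x y
    using that by (simp add: \<nu>_def)
  have D: "D t x y = \<mu> x y + (t * (a x * b y - a y * b x)) \<cdot>\<^sub>v z" for t x y
    by (simp add: deformed_bracket_def)
  have \<nu>_nil: "\<nu> t \<in> nilpotent_brackets n k" for t
  proof -
    have "complex_lie_algebra (bracket_algebra n (\<nu> t))"
      "at_most_step_nilpotent k (bracket_algebra n (\<nu> t))"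
      using complex_lie_algebra_deformed[of "\<nu> t" t] nilpotent_deformed[of "\<nu> t" t, OF _ nil k] \<nu>
      by auto
    moreover have "\<nu> t \<in> carrier_vec n \<rightarrow>\<^sub>E (carrier_vec n \<rightarrow>\<^sub>E carrier_vec n)"
      using D_closed by (auto simp: \<nu>_def)
    ultimately show ?thesis by (simp add: nilpotent_brackets_def)
  qed
  have "\<nu> 0 x y = \<mu> x y" for x y
  proof (cases "x \<in> carrier_vec n")
    case True
    then have "\<mu> x \<in> carrier_vec n \<rightarrow>\<^sub>E carrier_vec n" using \<mu>E by auto
    then show ?thesis using True \<mu>_closed[of x y] z' by (auto simp: \<nu>_def D)
  next
    case False
    then show ?thesis using \<mu>E by (auto simp: \<nu>_def)
  qed
  then have \<nu>0: "\<nu> 0 = \<mu>" by (intro ext)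
  \<comment> \<open>Restricted to the line, a polynomial in the structure constants is a polynomial
    in \<open>t\<close>, because each structure constant of \<open>\<nu> t\<close> is affine in
    \<open>t\<close>.\<close>
  have poly: "\<exists>q. \<forall>t. p (\<nu> t) = poly q t" if "p \<in> bracket_polynomials n" for p
    using that
  proof induction
    case (const c)
    show ?case by (intro exI[of _ "[:c:]"]) simp
  next
    case (coord i j l)
    let ?x = "unit_vec n i :: complex vec" and ?y = "unit_vec n j :: complex vec"
    have "\<nu> t ?x ?y $ l = poly [:\<mu> ?x ?y $ l, (a ?x * b ?y - a ?y * b ?x) * z $ l:] t" for t
      using coord z' \<mu>_closed[of ?x ?y] by (simp add: \<nu> D)
    then show ?case by blast
  next
    case (add p q)
    then show ?case by (metis poly_add)
  next
    case (mult p q)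
    then show ?case by (metis poly_mult)
  qed
  have "\<mu> \<in> bracket_orbit n \<mu>" using \<mu>E by (rule mem_bracket_orbit_self)
  then obtain p where p: "p \<in> P" "p \<mu> \<noteq> 0" using orbit by blast
  then obtain q where q: "\<And>t. p (\<nu> t) = poly q t" using poly P by blast
  have "q \<noteq> 0" using q[of 0] p \<nu>0 by auto
  \<comment> \<open>Inserting 0 makes the parameter found next nonzero.\<close>
  then have "finite (insert 0 {t. poly q t = 0})" by (simp add: poly_roots_finite)
  then obtain t where t: "t \<noteq> 0" "poly q t \<noteq> 0"
    using ex_new_if_finite[OF infinite_UNIV_char_0] by blast
  then have "p (\<nu> t) \<noteq> 0" by (simp add: q)
  then have "\<nu> t \<in> bracket_orbit n \<mu>" using orbit \<nu>_nil p by blast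
  then obtain h where h: "h \<in> GL_complex n" and \<nu>h: "\<nu> t = GL_action n h \<mu>"
    by (auto simp: bracket_orbit_def)
  define h' where "h' = inv\<^bsub>complex_mat_ring n\<^esub> h"
  note hh = GL_complex_inverse[OF h, folded h'_def]
  have hh_vec: "h *\<^sub>v (h' *\<^sub>v x) = x" "h' *\<^sub>v (h *\<^sub>v x) = x" if "x \<in> carrier_vec n" for x
    using hh that by (simp_all flip: assoc_mult_mat_vec)
  have h_closed: "h *\<^sub>v x \<in> carrier_vec n" "h' *\<^sub>v x \<in> carrier_vec n"
    if "x \<in> carrier_vec n" for x
    using hh(1,2) that by simp_all
  have Dh: "D t x y = h *\<^sub>v \<mu> (h' *\<^sub>v x) (h' *\<^sub>v y)" if "x \<in> carrier_vec n" "y \<in> carrier_vec n" for x y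
    using \<nu>[OF that, of t] that by (simp add: \<nu>h GL_action_def h'_def)
  \<comment> \<open>From \<open>\<nu> t = GL_action n h \<mu>\<close> it follows that
    \<open>h\<close> carries \<open>\<mu>\<close> to the deformed bracket and its inverse carries it
    back.\<close>
  have "deformation_isomorphism t ((*\<^sub>v) h) ((*\<^sub>v) h')"
    unfolding deformation_isomorphism_def
    using hh(1,2) h_closed
    by (auto simp: Dh hh_vec \<mu>_closed mult_add_distrib_mat_vec mult_mat_vec)
  then show False using nontriv t by (auto simp: nontrivial_def)
qed

theorem theorem3p3:
  fixes V :: "'v set" and E :: "'v set set" and k :: nat
  assumes "finite_simple_graph V E" and "card V \<ge> 3"
    and "\<not> complete_graph V E" and "k \<ge> 3"
  shows "\<not> k_rigid k (graph_lie_algebra k V E)"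
proof
  assume "k_rigid k (graph_lie_algebra k V E)"
  then obtain n \<mu> where iso: "lie_isomorphic (graph_lie_algebra k V E) (bracket_algebra n \<mu>)"
    and rigid: "k_rigid_bracket n k \<mu>"
    by (auto simp: k_rigid_def)
  let ?L = "bracket_algebra n \<mu>"
  have \<mu>: "\<mu> \<in> nilpotent_brackets n k" using rigid by (simp add: k_rigid_bracket_def)
  then have L: "complex_lie_algebra ?L" and nil: "at_most_step_nilpotent k ?L"
    by (auto simp: nilpotent_brackets_def)
  interpret complex_lie_algebra ?L by (rule L)
  have k: "k \<ge> 1" "k \<ge> 2" using assms(4) by auto
  obtain g where g: "graph_presented k V E ?L g"
    using graph_presented_isomorphic[OF graph_lie(2,1)[OF k(1)] iso complex_algebra_axioms] by blast
  have V: "finite V" and E: "E \<subseteq> all_edges V" using assms(1) by (auto simp: finite_simple_graph_def)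
  have "\<exists>a b z. central_deformation ?L a b z \<and> central_deformation.nontrivial ?L a b z"
  proof (cases "E = {}")
    case True
    then show ?thesis using deformation_abelian[OF L _ assms(2)] g by blast
  next
    case False
    \<comment> \<open>Some vertex has both a neighbour and a non-neighbour. Otherwise each vertex
      with a neighbour is adjacent to all others; an end \<open>p\<close> of an edge is such a
      vertex, so every vertex has a neighbour and the graph is complete.\<close>
    have "\<exists>u w c. u \<in> V \<and> w \<in> V \<and> u \<noteq> w \<and> {u, w} \<notin> E \<and> c \<in> V \<and> {c, u} \<in> E"
    proof (rule ccontr)
      assume *: "\<not> ?thesis"
      obtain p q where pq: "p \<in> V" "q \<in> V" "{p, q} \<in> E"
        using False E by (fastforce simp: all_edges_def)
      have full: "{x, y} \<in> E" if "x \<in> V" "y \<in> V" "x \<noteq> y" "c \<in> V" "{c, x} \<in> E" for x y c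
        using * that by blast
      have "{x, y} \<in> E" if xy: "x \<in> V" "y \<in> V" "x \<noteq> y" for x y
      proof (cases "x = p")
        case True
        then show ?thesis using full[OF xy, of q] pq by (simp add: insert_commute)
      next
        case False
        then have "{p, x} \<in> E" using full[of p x q] pq xy by (auto simp: insert_commute)
        then show ?thesis using full[OF xy, of p] pq by simp
      qed
      then have "E = all_edges V" using E by (auto simp: all_edges_def)
      then show False using assms(3) by (simp add: complete_graph_def)
    qed
    then obtain u w c where uwc: "u \<in> V" "w \<in> V" "u \<noteq> w" "{u, w} \<notin> E" "c \<in> V" "{c, u} \<in> E"
      by blast
    then show ?thesis using deformation_edge[OF L g V E nil assms(4) uwc] by blast
  qed
  then show False using not_k_rigid_bracket[OF \<mu> k(2)] rigid by blast
qed

end
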